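(* (a) If $G\cong D_{2m}$ or $G\cong U_{(n,m)}$ (with $n\ge2$), where $m\ge4$ and both $m$ and $m/2$ are even, then $\Gamma_G$ is Q-integral iff $m=4$. (b) If $G\cong T_{4m}$ with $m\ge2$ even, then $\Gamma_G$ is Q-integral iff $m=2$. (c) If $G\cong V_{8m}$ with $m\ge2$, then $\Gamma_G$ is Q-integral iff $m=2$. (d) If $G\cong SD_{8m}$ with $m\ge2$ even, then $\Gamma_G$ is not Q-integral.
   Context: Groups: $D_{2m}=\langle x,y\mid x^m=y^2=1,\ yxy^{-1}=x^{-1}\rangle$; $T_{4m}=\langle x,y\mid x^{2m}=1,\ x^m=y^2,\ y^{-1}xy=x^{-1}\rangle$; $SD_{8m}=\langle x,y\mid x^{4m}=y^2=1,\ yxy=x^{2m-1}\rangle$; $U_{(n,m)}=\langle x,y\mid x^{2n}=y^m=1,\ x^{-1}yx=y^{-1}\rangle$; $V_{8m}=\langle x,y\mid x^{2m}=y^4=1,\ yx=x^{-1}y^{-1},\ y^{-1}x=x^{-1}y\rangle$. The NCCC-graph $\Gamma_G$ of a finite non-abelian group $G$ has vertex set $\{x^G: x\in G\setminus Z(G)\}$ ($x^G$ the conjugacy class of $x$), distinct vertices $x^G,y^G$ adjacent iff $x'y'\neq y'x'$ for all $x'\in x^G,y'\in y^G$. A graph is Q-integral if all eigenvalues of its signless Laplacian $Q=D+A$ ($A$ adjacency, $D$ degree matrix) are integers. *)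

theory Defs
  imports "HOL-Algebra.Algebra"
begin

definition centre :: "('a, 'b) monoid_scheme \<Rightarrow> 'a set" where
  "centre G = {z \<in> carrier G. \<forall>g \<in> carrier G. z \<otimes>\<^bsub>G\<^esub> g = g \<otimes>\<^bsub>G\<^esub> z}"

definition conj_class :: "('a, 'b) monoid_scheme \<Rightarrow> 'a \<Rightarrow> 'a set" where
  "conj_class G x = {inv\<^bsub>G\<^esub> g \<otimes>\<^bsub>G\<^esub> x \<otimes>\<^bsub>G\<^esub> g | g. g \<in> carrier G}"

definition nccc_vertices :: "('a, 'b) monoid_scheme \<Rightarrow> 'a set set" where
  "nccc_vertices G = conj_class G ` (carrier G - centre G)"

definition nccc_adj :: "('a, 'b) monoid_scheme \<Rightarrow> 'a set \<Rightarrow> 'a set \<Rightarrow> bool" where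
  "nccc_adj G A B \<longleftrightarrow> A \<in> nccc_vertices G \<and> B \<in> nccc_vertices G \<and> A \<noteq> B \<and>
     (\<forall>a \<in> A. \<forall>b \<in> B. a \<otimes>\<^bsub>G\<^esub> b \<noteq> b \<otimes>\<^bsub>G\<^esub> a)"

text \<open>A finite simple graph is given by a finite vertex set V and a symmetric irreflexive
  adjacency relation E. The signless Laplacian Q = D + A acts on vectors f : V \<rightarrow> \<complex> by
  (Q f)(v) = deg(v) f(v) + sum of f(u) over neighbours u of v.\<close>

definition gdeg :: "'v set \<Rightarrow> ('v \<Rightarrow> 'v \<Rightarrow> bool) \<Rightarrow> 'v \<Rightarrow> nat" where
  "gdeg V E v = card {u \<in> V. E v u}"

definition signless_laplacian_apply ::
  "'v set \<Rightarrow> ('v \<Rightarrow> 'v \<Rightarrow> bool) \<Rightarrow> ('v \<Rightarrow> complex) \<Rightarrow> 'v \<Rightarrow> complex" where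
  "signless_laplacian_apply V E f v =
     of_nat (gdeg V E v) * f v + (\<Sum>u \<in> V. (if E v u then 1 else 0) * f u)"

definition Q_eigenvalue :: "'v set \<Rightarrow> ('v \<Rightarrow> 'v \<Rightarrow> bool) \<Rightarrow> complex \<Rightarrow> bool" where
  "Q_eigenvalue V E \<mu> \<longleftrightarrow>
     (\<exists>f. (\<exists>v \<in> V. f v \<noteq> 0) \<and> (\<forall>v \<in> V. signless_laplacian_apply V E f v = \<mu> * f v))"

definition Q_integral :: "'v set \<Rightarrow> ('v \<Rightarrow> 'v \<Rightarrow> bool) \<Rightarrow> bool" where
  "Q_integral V E \<longleftrightarrow> (\<forall>\<mu>. Q_eigenvalue V E \<mu> \<longrightarrow> \<mu> \<in> \<int>)"

definition nccc_Q_integral :: "('a, 'b) monoid_scheme \<Rightarrow> bool" where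
  "nccc_Q_integral G \<longleftrightarrow> Q_integral (nccc_vertices G) (nccc_adj G)"

text \<open>G is isomorphic to the group presented by generators x, y and given relations iff
  G is generated by two elements x, y satisfying the relations and G has the order of
  the presented group (so the canonical epimorphism from the presented group is an
  isomorphism).  The orders are |D_2m| = 2m, |T_4m| = 4m, |SD_8m| = 8m,
  |U_(n,m)| = 2nm, |V_8m| = 8m.\<close>

definition is_D :: "('a, 'b) monoid_scheme \<Rightarrow> nat \<Rightarrow> bool" where
  "is_D G m \<longleftrightarrow> (\<exists>x \<in> carrier G. \<exists>y \<in> carrier G.
     generate G {x, y} = carrier G \<and> order G = 2 * m \<and>
     x [^]\<^bsub>G\<^esub> m = \<one>\<^bsub>G\<^esub> \<and> y [^]\<^bsub>G\<^esub> (2::nat) = \<one>\<^bsub>G\<^esub> \<and>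
     y \<otimes>\<^bsub>G\<^esub> x \<otimes>\<^bsub>G\<^esub> inv\<^bsub>G\<^esub> y = inv\<^bsub>G\<^esub> x)"

definition is_T :: "('a, 'b) monoid_scheme \<Rightarrow> nat \<Rightarrow> bool" where
  "is_T G m \<longleftrightarrow> (\<exists>x \<in> carrier G. \<exists>y \<in> carrier G.
     generate G {x, y} = carrier G \<and> order G = 4 * m \<and>
     x [^]\<^bsub>G\<^esub> (2 * m) = \<one>\<^bsub>G\<^esub> \<and> x [^]\<^bsub>G\<^esub> m = y [^]\<^bsub>G\<^esub> (2::nat) \<and>
     inv\<^bsub>G\<^esub> y \<otimes>\<^bsub>G\<^esub> x \<otimes>\<^bsub>G\<^esub> y = inv\<^bsub>G\<^esub> x)"

definition is_SD :: "('a, 'b) monoid_scheme \<Rightarrow> nat \<Rightarrow> bool" where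
  "is_SD G m \<longleftrightarrow> (\<exists>x \<in> carrier G. \<exists>y \<in> carrier G.
     generate G {x, y} = carrier G \<and> order G = 8 * m \<and>
     x [^]\<^bsub>G\<^esub> (4 * m) = \<one>\<^bsub>G\<^esub> \<and> y [^]\<^bsub>G\<^esub> (2::nat) = \<one>\<^bsub>G\<^esub> \<and>
     y \<otimes>\<^bsub>G\<^esub> x \<otimes>\<^bsub>G\<^esub> y = x [^]\<^bsub>G\<^esub> (2 * m - 1))"

definition is_U :: "('a, 'b) monoid_scheme \<Rightarrow> nat \<Rightarrow> nat \<Rightarrow> bool" where
  "is_U G n m \<longleftrightarrow> (\<exists>x \<in> carrier G. \<exists>y \<in> carrier G.
     generate G {x, y} = carrier G \<and> order G = 2 * n * m \<and>
     x [^]\<^bsub>G\<^esub> (2 * n) = \<one>\<^bsub>G\<^esub> \<and> y [^]\<^bsub>G\<^esub> m = \<one>\<^bsub>G\<^esub> \<and>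
     inv\<^bsub>G\<^esub> x \<otimes>\<^bsub>G\<^esub> y \<otimes>\<^bsub>G\<^esub> x = inv\<^bsub>G\<^esub> y)"

definition is_V :: "('a, 'b) monoid_scheme \<Rightarrow> nat \<Rightarrow> bool" where
  "is_V G m \<longleftrightarrow> (\<exists>x \<in> carrier G. \<exists>y \<in> carrier G.
     generate G {x, y} = carrier G \<and> order G = 8 * m \<and>
     x [^]\<^bsub>G\<^esub> (2 * m) = \<one>\<^bsub>G\<^esub> \<and> y [^]\<^bsub>G\<^esub> (4::nat) = \<one>\<^bsub>G\<^esub> \<and>
     y \<otimes>\<^bsub>G\<^esub> x = inv\<^bsub>G\<^esub> x \<otimes>\<^bsub>G\<^esub> inv\<^bsub>G\<^esub> y \<and>
     inv\<^bsub>G\<^esub> y \<otimes>\<^bsub>G\<^esub> x = inv\<^bsub>G\<^esub> x \<otimes>\<^bsub>G\<^esub> y)"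

end

theory Submission
  imports Defs
begin

text \<open>
  In each of the five families, \<open>G / Z(G)\<close> is a dihedral group of order \<open>2 r\<close> with \<open>r\<close> even, generated
  by the images of a rotation \<open>x\<close> and a reflection \<open>y\<close>. Elements of \<open>\<langle>x\<rangle> Z(G)\<close> commute with each other,
  a non-central one commutes with nothing outside, and two elements outside commute iff their quotient
  is central. The class of an outside element consists of its translates by the powers of
  a commutator of order \<open>r\<close>, so the parity of the exponent of \<open>x\<close> splits the outside classes into two
  halves. Hence the graph is complete tripartite with parts of sizes \<open>n (r - 1), n, n\<close>, where \<open>n = |Z(G)| / 2\<close>.
  With \<open>k = r - 1\<close>, its signless Laplacian has the eigenvalues \<open>n (k + 4 \<plusminus> sqrt (k^2 + 8 k)) / 2\<close>, and
  \<open>k^2 + 8 k\<close> is a square only for \<open>k = 1\<close>. So the graph is Q-integral iff \<open>r = 2\<close>.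
\<close>

section \<open>Complete tripartite graphs\<close>

lemma signless_laplacian_apply_neighbours:
  assumes "finite V" "{u \<in> V. E v u} = N"
  shows "signless_laplacian_apply V E f v = of_nat (card N) * f v + sum f N"
proof -
  have "(\<Sum>u\<in>V. (if E v u then 1 else 0) * f u) = (\<Sum>u\<in>V. if E v u then f u else 0)"
    by (intro sum.cong) auto
  also have "\<dots> = sum f {u \<in> V. E v u}"
    using assms(1) by (simp add: sum.inter_filter)
  finally show ?thesis
    using assms(2) by (simp add: signless_laplacian_apply_def gdeg_def)
qed

text \<open>Since \<open>k^2 + 8 k\<close> lies strictly between the squares of \<open>k + 1\<close>
  and \<open>k + 4\<close>, its root can only be \<open>k + 2\<close> or \<open>k + 3\<close>. The
  first gives \<open>4 k = 4\<close>, the second \<open>2 k = 9\<close>, which parity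
  excludes.\<close>

lemma sq_plus_8_times_square:
  fixes k t :: int
  assumes "k > 0" "k\<^sup>2 + 8 * k = t\<^sup>2"
  shows "k = 1"
proof -
  define s where "s = \<bar>t\<bar>"
  have s: "s\<^sup>2 = k\<^sup>2 + 8 * k" "s \<ge> 0" using assms by (auto simp: s_def)
  have "(k + 1)\<^sup>2 < s\<^sup>2" "s\<^sup>2 < (k + 4)\<^sup>2"
    using s assms(1) by (auto simp: power2_eq_square algebra_simps)
  then have "k + 1 < s" "s < k + 4"
    using s(2) assms(1) by (auto intro: power2_less_imp_less)
  then consider "s = k + 2" | "s = k + 3" by linarith
  then show ?thesis
  proof cases
    case 1
    then have "4 * k = 4" using s(1) by (simp add: power2_eq_square algebra_simps)
    then show ?thesis by simp
  next
    case 2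
    then have "2 * k = 9" using s(1) by (simp add: power2_eq_square algebra_simps)
    then show ?thesis by presburger
  qed
qed

text \<open>The forward direction tests a single eigenvalue, belonging to a vector constant on
  \<open>P\<close> and on the union of \<open>Q\<close> and \<open>R\<close>; it is an integer only
  for \<open>k = 1\<close>. The converse needs all eigenvalues, but then the three parts have the
  same size \<open>n\<close>, and summing the eigenvalue equation over each part suffices.\<close>

lemma Q_integral_complete_tripartite_iff:
  fixes V P Q R :: "'v set" and E :: "'v \<Rightarrow> 'v \<Rightarrow> bool" and n k :: nat
  assumes fin: "finite V" and V: "V = P \<union> Q \<union> R"
    and disj: "P \<inter> Q = {}" "P \<inter> R = {}" "Q \<inter> R = {}"
    and card: "card P = n * k" "card Q = n" "card R = n" and pos: "n > 0" "k > 0"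
    and E: "\<And>u v. u \<in> V \<Longrightarrow> v \<in> V \<Longrightarrow>
      E u v \<longleftrightarrow> \<not> (u \<in> P \<and> v \<in> P \<or> u \<in> Q \<and> v \<in> Q \<or> u \<in> R \<and> v \<in> R)"
  shows "Q_integral V E \<longleftrightarrow> k = 1"
proof
  have finPQR: "finite P" "finite Q" "finite R" using fin V by auto
  have N: "{u \<in> V. E v u} = Q \<union> R" if "v \<in> P" for v
    using that E[of v] disj by (auto simp: V)
  have N': "{u \<in> V. E v u} = P \<union> R" if "v \<in> Q" for v
    using that E[of v] disj by (auto simp: V)
  have N'': "{u \<in> V. E v u} = P \<union> Q" if "v \<in> R" for v
    using that E[of v] disj by (auto simp: V)
  have SP: "signless_laplacian_apply V E f v = of_nat (2 * n) * f v + (sum f Q + sum f R)"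
    if "v \<in> P" for f v
    using signless_laplacian_apply_neighbours[where f = f and E = E and v = v, OF fin N[OF that]] finPQR disj card
    by (simp add: card_Un_disjoint sum.union_disjoint)
  have SQ: "signless_laplacian_apply V E f v = of_nat (n * k + n) * f v + (sum f P + sum f R)"
    if "v \<in> Q" for f v
    using signless_laplacian_apply_neighbours[where f = f and E = E and v = v, OF fin N'[OF that]] finPQR disj card
    by (simp add: card_Un_disjoint sum.union_disjoint)
  have SR: "signless_laplacian_apply V E f v = of_nat (n * k + n) * f v + (sum f P + sum f Q)"
    if "v \<in> R" for f v
    using signless_laplacian_apply_neighbours[where f = f and E = E and v = v, OF fin N''[OF that]] finPQR disj card
    by (simp add: card_Un_disjoint sum.union_disjoint)

  show "k = 1" if int: "Q_integral V E"
  proof -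
    \<comment> \<open>On vectors equal to \<open>a\<close> on \<open>P\<close> and to
      \<open>b\<close> on \<open>Q\<close> and \<open>R\<close>, the operator acts as the matrix
      with rows \<open>(2 n, 2 n)\<close> and \<open>(n k, n k + 2 n)\<close>. Its characteristic
      equation is \<open>quad\<close>, with discriminant \<open>(n d)^2\<close>, and
      \<open>m\<close> is the larger root.\<close>
    define d where "d = sqrt (real (k\<^sup>2 + 8 * k))"
    have d2: "d * d = real k * real k + 8 * real k"
      by (simp add: d_def power2_eq_square)
    define m where "m = real n * (real k + 4 + d) / 2"
    have quad: "m * m = (real n * real k + 4 * real n) * m - 4 * real n * real n"
    proof -
      have "4 * (m * m - ((real n * real k + 4 * real n) * m - 4 * real n * real n))
        = real n * real n * (d * d - (real k * real k + 8 * real k))"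
        by (simp add: m_def field_simps)
      then show ?thesis by (simp add: d2)
    qed
    \<comment> \<open>The first row of that matrix, \<open>2 n a + 2 n b = m a\<close>, is solved by
      \<open>a = 2 n\<close> and \<open>b = m - 2 n\<close>. The second row then amounts to
      \<open>quad\<close>.\<close>
    define f :: "'v \<Rightarrow> complex" where
      "f v = of_real (if v \<in> P then 2 * real n else m - 2 * real n)" for v
    have sums: "sum f P = of_real (real (n * k) * (2 * real n))"
      "sum f Q = of_real (real n * (m - 2 * real n))"
      "sum f R = of_real (real n * (m - 2 * real n))"
    proof -
      have "sum f P = (\<Sum>v\<in>P. of_real (2 * real n))"
        by (intro sum.cong) (auto simp: f_def)
      then show "sum f P = of_real (real (n * k) * (2 * real n))" by (simp add: card)
      have "sum f Q = (\<Sum>v\<in>Q. of_real (m - 2 * real n))"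
        using disj by (intro sum.cong) (auto simp: f_def)
      then show "sum f Q = of_real (real n * (m - 2 * real n))" by (simp add: card)
      have "sum f R = (\<Sum>v\<in>R. of_real (m - 2 * real n))"
        using disj by (intro sum.cong) (auto simp: f_def)
      then show "sum f R = of_real (real n * (m - 2 * real n))" by (simp add: card)
    qed
    have fP: "f v = of_real (2 * real n)" if "v \<in> P" for v using that by (simp add: f_def)
    have fQR: "f v = of_real (m - 2 * real n)" if "v \<in> Q \<or> v \<in> R" for v
      using that disj by (auto simp: f_def)
    have eq1: "real (2 * n) * (2 * real n) + (real n * (m - 2 * real n) + real n * (m - 2 * real n))
        = m * (2 * real n)"
      by (simp add: algebra_simps)
    have eq2: "real (n * k + n) * (m - 2 * real n)
        + (real (n * k) * (2 * real n) + real n * (m - 2 * real n)) = m * (m - 2 * real n)"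
      using quad by (simp add: algebra_simps)
    have "P \<noteq> {}" using card(1) pos by (metis card.empty mult_eq_0_iff not_gr_zero)
    then obtain p where p: "p \<in> P" by blast
    have ev: "\<forall>v\<in>V. signless_laplacian_apply V E f v = of_real m * f v"
    proof
      fix v assume "v \<in> V"
      then consider "v \<in> P" | "v \<in> Q" | "v \<in> R" using V by blast
      then show "signless_laplacian_apply V E f v = of_real m * f v"
      proof cases
        case 1
        then show ?thesis using arg_cong[OF eq1, of complex_of_real] by (simp add: SP sums fP card)
      next
        case 2
        then show ?thesis using arg_cong[OF eq2, of complex_of_real] by (simp add: SQ sums fQR card)
      next
        case 3
        then show ?thesis using arg_cong[OF eq2, of complex_of_real] by (simp add: SR sums fQR card)
      qed
    qed
    have "p \<in> V" "f p \<noteq> 0" using p V fP[OF p] pos by auto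
    with ev have "Q_eigenvalue V E (of_real m)"
      unfolding Q_eigenvalue_def by blast
    then have "complex_of_real m \<in> \<int>" using int unfolding Q_integral_def by blast
    then obtain a :: int where a: "m = of_int a"
      by (metis Ints_cases of_real_eq_iff of_real_of_int_eq)
    \<comment> \<open>Twice the eigenvalue minus the trace of the matrix is the root
      \<open>n d\<close> of the discriminant. So \<open>n^2 (k^2 + 8 k)\<close> is the square of an
      integer, and \<open>n^2\<close> can be divided out.\<close>
    define t where "t = 2 * a - int (n * (k + 4))"
    have "real_of_int t = real n * d" by (simp add: t_def a[symmetric] m_def field_simps)
    then have "real_of_int (t * t) = real n * real n * (d * d)" by simp
    also have "\<dots> = real_of_int (int n * int n * (int k * int k + 8 * int k))" by (simp add: d2)
    finally have t: "t\<^sup>2 = (int n)\<^sup>2 * ((int k)\<^sup>2 + 8 * int k)"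
      by (simp add: power2_eq_square del: of_int_mult)
    then have "(int n)\<^sup>2 dvd t\<^sup>2" by simp
    then have "int n dvd t" by simp
    then obtain s where "t = int n * s" by blast
    with t pos have "(int k)\<^sup>2 + 8 * int k = s\<^sup>2" by (simp add: power_mult_distrib)
    then show "k = 1" using sq_plus_8_times_square[of "int k" s] pos by simp
  qed

  show "Q_integral V E" if k: "k = 1"
    unfolding Q_integral_def
  proof (intro allI impI)
    fix \<mu> assume "Q_eigenvalue V E \<mu>"
    then obtain f v0 where v0: "v0 \<in> V" "f v0 \<noteq> 0"
      and ev: "\<And>v. v \<in> V \<Longrightarrow> signless_laplacian_apply V E f v = \<mu> * f v"
      unfolding Q_eigenvalue_def by blast
    define N :: complex where "N = of_nat n"
    define S where "S = sum f P + sum f Q + sum f R"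
    have eP: "(\<mu> - 2 * N) * f v = S - sum f P" if "v \<in> P" for v
      using ev[of v] SP[OF that, of f] that V by (simp add: N_def S_def algebra_simps)
    have eQ: "(\<mu> - 2 * N) * f v = S - sum f Q" if "v \<in> Q" for v
      using ev[of v] SQ[OF that, of f] that V k by (simp add: N_def S_def algebra_simps)
    have eR: "(\<mu> - 2 * N) * f v = S - sum f R" if "v \<in> R" for v
      using ev[of v] SR[OF that, of f] that V k by (simp add: N_def S_def algebra_simps)
    \<comment> \<open>With all parts of size \<open>n\<close>, the sum of the equation over a part
      says that \<open>\<mu> - N\<close> times the sum over that part is \<open>N * S\<close>.
      Adding the three parts gives \<open>(\<mu> - 4 * N) * S = 0\<close>.\<close>
    have "(\<mu> - 2 * N) * sum f P = (\<Sum>v\<in>P. S - sum f P)"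
      by (simp add: sum_distrib_left eP)
    then have sP: "(\<mu> - N) * sum f P = N * S" using card k by (simp add: N_def algebra_simps)
    have "(\<mu> - 2 * N) * sum f Q = (\<Sum>v\<in>Q. S - sum f Q)"
      by (simp add: sum_distrib_left eQ)
    then have sQ: "(\<mu> - N) * sum f Q = N * S" using card k by (simp add: N_def algebra_simps)
    have "(\<mu> - 2 * N) * sum f R = (\<Sum>v\<in>R. S - sum f R)"
      by (simp add: sum_distrib_left eR)
    then have sR: "(\<mu> - N) * sum f R = N * S" using card k by (simp add: N_def algebra_simps)
    have "(\<mu> - N) * S = 3 * (N * S)"
      using sP sQ sR by (simp add: S_def algebra_simps)
    then have "(\<mu> - 4 * N) * S = 0" by (simp add: algebra_simps)
    then consider "\<mu> = 4 * N" | "S = 0" by auto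
    then have "\<mu> = 4 * N \<or> \<mu> = N \<or> \<mu> = 2 * N"
    proof cases
      \<comment> \<open>If \<open>S = 0\<close> and \<mu> differs from \<open>N\<close>, the sum
        over every part vanishes, and the equation at a vertex where \<open>f\<close> is nonzero
        leaves only \<open>2 * N\<close>.\<close>
      case 2
      have "\<mu> = 2 * N" if "\<mu> \<noteq> N"
      proof -
        have "sum f P = 0" "sum f Q = 0" "sum f R = 0" using sP sQ sR 2 that by auto
        then have "(\<mu> - 2 * N) * f v0 = 0" using eP eQ eR 2 v0(1) V by auto
        then show ?thesis using v0(2) by simp
      qed
      then show ?thesis by blast
    qed simp
    then show "\<mu> \<in> \<int>" by (auto simp: N_def)
  qed
qed

section \<open>Groups that are dihedral modulo their centre\<close>

context group
begin

lemma inv_cancel_left: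
  assumes "a \<in> carrier G" "b \<in> carrier G"
  shows "a \<otimes> (inv a \<otimes> b) = b" "inv a \<otimes> (a \<otimes> b) = b"
  using assms by (simp_all flip: m_assoc)

lemma centreD: "z \<in> centre G \<Longrightarrow> z \<in> carrier G"
  by (simp add: centre_def)

lemma centre_comm: "z \<in> centre G \<Longrightarrow> g \<in> carrier G \<Longrightarrow> z \<otimes> g = g \<otimes> z"
  by (simp add: centre_def)

lemma subgroup_centre: "subgroup (centre G) G"
proof
  show "centre G \<subseteq> carrier G" by (auto simp: centre_def)
  show "\<one> \<in> centre G" by (simp add: centre_def)
next
  fix a b assume ab: "a \<in> centre G" "b \<in> centre G"
  have [simp]: "a \<in> carrier G" "b \<in> carrier G" using ab by (auto simp: centreD)
  show "a \<otimes> b \<in> centre G"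
    unfolding centre_def
  proof (intro CollectI conjI ballI)
    fix g assume [simp]: "g \<in> carrier G"
    show "a \<otimes> b \<otimes> g = g \<otimes> (a \<otimes> b)"
      using centre_comm[OF ab(1), of g] centre_comm[OF ab(2), of g]
      by (metis \<open>a \<in> carrier G\<close> \<open>b \<in> carrier G\<close> \<open>g \<in> carrier G\<close> m_assoc)
  qed simp
next
  fix a assume a: "a \<in> centre G"
  have [simp]: "a \<in> carrier G" using a by (rule centreD)
  show "inv a \<in> centre G"
    unfolding centre_def
  proof (intro CollectI conjI ballI)
    fix g assume [simp]: "g \<in> carrier G"
    show "inv a \<otimes> g = g \<otimes> inv a"
      using centre_comm[OF a, of "inv g"] by (metis \<open>a \<in> carrier G\<close> \<open>g \<in> carrier G\<close> inv_closed inv_inv inv_mult_group)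
  qed simp
qed

lemmas centre_closed =
  subgroup.m_closed[OF subgroup_centre] subgroup.m_inv_closed[OF subgroup_centre]
  subgroup.one_closed[OF subgroup_centre] subgroup_int_pow_closed[OF subgroup_centre]

lemma conj_class_self: "x \<in> carrier G \<Longrightarrow> x \<in> conj_class G x"
  unfolding conj_class_def by (rule CollectI, rule exI[of _ \<one>]) simp

lemma conj_class_eqI:
  assumes x: "x \<in> carrier G" and y: "y \<in> conj_class G x"
  shows "conj_class G y = conj_class G x"
proof -
  obtain g where g: "g \<in> carrier G" and y_def: "y = inv g \<otimes> x \<otimes> g"
    using y by (auto simp: conj_class_def)
  have "inv h \<otimes> y \<otimes> h = inv (g \<otimes> h) \<otimes> x \<otimes> (g \<otimes> h)" if "h \<in> carrier G" for h
    using that x g by (simp add: y_def inv_mult_group m_assoc)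
  moreover have "inv h \<otimes> x \<otimes> h = inv (inv g \<otimes> h) \<otimes> y \<otimes> (inv g \<otimes> h)" if "h \<in> carrier G" for h
    using that x g by (simp add: y_def inv_mult_group m_assoc inv_cancel_left)
  ultimately show ?thesis
    using g unfolding conj_class_def by (auto; metis inv_closed m_closed)
qed

lemma conj_class_disjoint:
  assumes "x \<in> carrier G" "y \<in> carrier G" "conj_class G x \<noteq> conj_class G y"
  shows "conj_class G x \<inter> conj_class G y = {}"
proof -
  have "conj_class G x = conj_class G y" if "z \<in> conj_class G x" "z \<in> conj_class G y" for z
    using conj_class_eqI[OF assms(1) that(1)] conj_class_eqI[OF assms(2) that(2)] by simp
  then show ?thesis using assms(3) by blast
qed

text \<open>Distinct classes are disjoint and cover \<open>S\<close>, so a common class size makes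
  counting the classes a matter of division.\<close>

lemma card_conj_classes:
  assumes "finite S" "S \<subseteq> carrier G" and closed: "\<And>x. x \<in> S \<Longrightarrow> conj_class G x \<subseteq> S"
    and card: "\<And>x. x \<in> S \<Longrightarrow> card (conj_class G x) = s"
  shows "s * card (conj_class G ` S) = card S"
proof -
  have U: "\<Union> (conj_class G ` S) = S"
    using assms(2) closed conj_class_self by blast
  have "s * card (conj_class G ` S) = card (\<Union> (conj_class G ` S))"
  proof (rule card_partition)
    show "finite (\<Union> (conj_class G ` S))" using U assms(1) by simp
  next
    fix c1 c2 assume "c1 \<in> conj_class G ` S" "c2 \<in> conj_class G ` S" "c1 \<noteq> c2"
    then show "c1 \<inter> c2 = {}" using conj_class_disjoint assms(2) by blast
  qed (use assms(1) card in auto)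
  then show ?thesis by (simp add: U)
qed

end

text \<open>The assumptions make \<open>G / Z(G)\<close> a dihedral group with rotation \<open>x\<close> and reflection \<open>y\<close>.
  All five families of groups satisfy them.\<close>

locale dihedral_mod_centre = group G for G (structure) +
  fixes x y c
  assumes finite_carrier: "finite (carrier G)"
    and x [simp]: "x \<in> carrier G" and y [simp]: "y \<in> carrier G"
    and normal_form: "\<And>g. g \<in> carrier G \<Longrightarrow> \<exists>(i::nat) (j::nat). g = x [^] i \<otimes> y [^] j"
    and y_square: "y \<otimes> y \<in> centre G"
    and c: "c \<in> centre G"
    and y_x: "y \<otimes> x = inv x \<otimes> c \<otimes> y"
begin

lemma c_carrier [simp]: "c \<in> carrier G"
  using c by (rule centreD)

text \<open>\<open>u\<close> is the commutator with \<open>y x y\<^sup>-\<^sup>1 = x u\<close>; its order is the order of \<open>x\<close> modulo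
  the centre, and its powers translate a reflection through its conjugacy class.\<close>

definition u where "u = inv x \<otimes> inv x \<otimes> c"

lemma u_carrier [simp]: "u \<in> carrier G"
  by (simp add: u_def)

text \<open>The first set is the subgroup generated by \<open>x\<close> and the centre. The second
  is one half of its coset by \<open>y\<close>: the parity of the exponent of \<open>x\<close> is
  even for \<open>True\<close> and odd for \<open>False\<close>.\<close>

definition rotations where
  "rotations = {x [^] (i::int) \<otimes> z | i z. z \<in> centre G}"
definition reflections where
  "reflections p = {x [^] (i::int) \<otimes> z \<otimes> y | i z. z \<in> centre G \<and> even i = p}"

section \<open>Commutation rules for rotations and reflections\<close>

lemma pow_centre: "z \<in> centre G \<Longrightarrow> z [^] (i::int) \<in> centre G"
  by (rule centre_closed)

lemma c_pow [simp]: "c [^] (i::int) \<in> centre G"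
  by (simp add: pow_centre c)

lemma x_pow_comm: "x [^] (i::int) \<otimes> x [^] (j::int) = x [^] j \<otimes> x [^] i"
  by (simp add: add.commute flip: int_pow_mult)

text \<open>Conjugation by \<open>y\<close> is an endomorphism taking \<open>x\<close> to
  \<open>inv x \<otimes> c\<close>, hence \<open>x^i\<close> to the \<open>i\<close>-th power of
  that product, which splits because \<open>c\<close> is central.\<close>

lemma y_x_pow: "y \<otimes> x [^] (i::int) = x [^] (-i) \<otimes> c [^] i \<otimes> y"
proof -
  have *: "y \<otimes> x \<otimes> inv y = inv x \<otimes> c"
    using y_x by (simp add: m_assoc)
  have "(\<lambda>g. y \<otimes> g \<otimes> inv y) \<in> hom G G"
    by (rule homI) (simp_all add: m_assoc inv_cancel_left)
  then have "y \<otimes> x [^] i \<otimes> inv y = (y \<otimes> x \<otimes> inv y) [^] i"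
    using Group.hom_int_pow[of "\<lambda>g. y \<otimes> g \<otimes> inv y" G G x i] is_group by simp
  also have "\<dots> = inv x [^] i \<otimes> c [^] i"
    unfolding * by (rule int_pow_mult_distrib) (simp_all add: centre_comm[OF c])
  finally have "y \<otimes> x [^] i \<otimes> inv y \<otimes> y = x [^] (-i) \<otimes> c [^] i \<otimes> y"
    by (simp add: int_pow_inv int_pow_neg)
  then show ?thesis by (simp add: m_assoc)
qed

lemma reflections_carrier: "g \<in> reflections p \<Longrightarrow> g \<in> carrier G"
  by (auto simp: reflections_def centreD)

lemma rotations_carrier: "g \<in> rotations \<Longrightarrow> g \<in> carrier G"
  by (auto simp: rotations_def centreD)

text \<open>Every reflection is a rotation times \<open>y\<close>, and powers of \<open>x\<close>
  commute with the rotation, so the rule for \<open>y\<close> carries over unchanged.\<close>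

lemma reflection_x_pow:
  assumes "g \<in> reflections p"
  shows "g \<otimes> x [^] (i::int) = x [^] (-i) \<otimes> c [^] i \<otimes> g"
proof -
  obtain j z where g: "g = x [^] (j::int) \<otimes> z \<otimes> y" and z: "z \<in> centre G"
    using assms by (auto simp: reflections_def)
  have [simp]: "z \<in> carrier G" using z by (rule centreD)
  define w where "w = c [^] i"
  have w: "w \<in> centre G" by (simp add: w_def)
  then have [simp]: "w \<in> carrier G" by (rule centreD)
  have "g \<otimes> x [^] i = x [^] j \<otimes> z \<otimes> (y \<otimes> x [^] i)" by (simp add: g m_assoc)
  also have "\<dots> = x [^] j \<otimes> (z \<otimes> (x [^] (-i) \<otimes> w)) \<otimes> y"
    by (simp add: y_x_pow w_def m_assoc)
  also have "z \<otimes> (x [^] (-i) \<otimes> w) = x [^] (-i) \<otimes> w \<otimes> z"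
    by (rule centre_comm[OF z]) simp
  also have "x [^] j \<otimes> (x [^] (-i) \<otimes> w \<otimes> z) = x [^] j \<otimes> x [^] (-i) \<otimes> w \<otimes> z"
    by (simp add: m_assoc)
  also have "\<dots> = x [^] (-i) \<otimes> (x [^] j \<otimes> w) \<otimes> z"
    by (simp add: x_pow_comm[of j "-i"] m_assoc)
  also have "x [^] j \<otimes> w = w \<otimes> x [^] j" using centre_comm[OF w, of "x [^] j"] by simp
  finally show ?thesis by (simp add: g w_def m_assoc)
qed

lemma u_pow: "u [^] (i::int) = x [^] (-2 * i) \<otimes> c [^] i"
proof -
  have "u [^] i = (inv x \<otimes> inv x) [^] i \<otimes> c [^] i"
    unfolding u_def by (rule int_pow_mult_distrib) (simp_all add: centre_comm[OF c])
  also have "(inv x \<otimes> inv x) [^] i = inv x [^] i \<otimes> inv x [^] i"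
    by (rule int_pow_mult_distrib) simp_all
  also have "\<dots> = x [^] (-2 * i)"
    by (simp add: int_pow_inv flip: int_pow_neg int_pow_mult)
  finally show ?thesis .
qed

text \<open>Here \<open>x^(-i) c^i\<close> is the conjugate of \<open>x^i\<close> by
  \<open>y\<close>, so this ties the order of \<open>u\<close> to the commuting of
  \<open>x^i\<close> with \<open>y\<close>.\<close>

lemma u_pow_eq_one: "u [^] (i::int) = \<one> \<longleftrightarrow> x [^] (-i) \<otimes> c [^] i = x [^] i"
proof -
  have "x [^] i \<otimes> u [^] i = x [^] (-i) \<otimes> c [^] i"
    by (simp add: u_pow flip: m_assoc int_pow_mult)
  then show ?thesis
    using l_cancel_one[of "x [^] i" "u [^] i"] by simp
qed

text \<open>Moving \<open>x^i\<close> past \<open>g\<close> turns it into \<open>x^(-i) c^i\<close>.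
  After cancelling \<open>g\<close> and \<open>z\<close>, commuting means
  \<open>x^i = x^(-i) c^i\<close>, that is, \<open>u^i = 1\<close>.\<close>

lemma commutes_reflection_iff:
  assumes g: "g \<in> reflections p" and z: "z \<in> centre G"
  shows "x [^] (i::int) \<otimes> z \<otimes> g = g \<otimes> (x [^] i \<otimes> z) \<longleftrightarrow> int (ord u) dvd i"
proof -
  have [simp]: "g \<in> carrier G" "z \<in> carrier G" "c [^] i \<in> carrier G"
    using g z by (auto simp: reflections_carrier centreD)
  have 1: "x [^] i \<otimes> z \<otimes> g = x [^] i \<otimes> (g \<otimes> z)"
    using centre_comm[OF z, of g] by (simp add: m_assoc)
  have 2: "g \<otimes> (x [^] i \<otimes> z) = x [^] (-i) \<otimes> c [^] i \<otimes> (g \<otimes> z)"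
    using reflection_x_pow[OF g, of i] by (simp add: m_assoc flip: m_assoc[of g])
  have "x [^] i \<otimes> z \<otimes> g = g \<otimes> (x [^] i \<otimes> z) \<longleftrightarrow> x [^] i = x [^] (-i) \<otimes> c [^] i"
    unfolding 1 2 by (subst r_cancel) auto
  also have "\<dots> \<longleftrightarrow> int (ord u) dvd i"
    using u_pow_eq_one[of i] int_pow_eq_id[of u i] by auto
  finally show ?thesis .
qed

lemma y_reflection: "y \<in> reflections True"
  unfolding reflections_def by (rule CollectI, rule exI[of _ 0], rule exI[of _ \<one>]) (simp add: centre_closed(3))

text \<open>By the normal form, an element commuting with \<open>x\<close> and \<open>y\<close> is
  central. For a power of \<open>x\<close> only \<open>y\<close> is in question, and
  \<open>y\<close> is a reflection, so \<open>commutes_reflection_iff\<close> decides.\<close>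

lemma x_pow_centre_iff: "x [^] (i::int) \<in> centre G \<longleftrightarrow> int (ord u) dvd i"
proof
  assume "x [^] i \<in> centre G"
  then show "int (ord u) dvd i"
    using commutes_reflection_iff[OF y_reflection, of \<one> i] by (simp add: centre_comm centre_closed)
next
  assume "int (ord u) dvd i"
  then have xy: "x [^] i \<otimes> y = y \<otimes> x [^] i"
    using commutes_reflection_iff[OF y_reflection, of \<one> i] by (simp add: centre_closed)
  show "x [^] i \<in> centre G"
    unfolding centre_def
  proof (intro CollectI conjI ballI)
    fix g assume "g \<in> carrier G"
    then obtain a b :: nat where g: "g = x [^] a \<otimes> y [^] b" using normal_form by blast
    have "x [^] i \<otimes> x [^] a = x [^] a \<otimes> x [^] i"
      using x_pow_comm[of i "int a"] by (simp add: int_pow_int)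
    moreover have "x [^] i \<otimes> y [^] b = y [^] b \<otimes> x [^] i"
      using group_commutes_pow[of y "x [^] i" b] xy by simp
    ultimately show "x [^] i \<otimes> g = g \<otimes> x [^] i"
      by (metis g int_pow_closed m_assoc nat_pow_closed x y)
  qed simp
qed

text \<open>As \<open>y^2\<close> is central, \<open>y^b\<close> is central or a central element
  times \<open>y\<close>, depending on the parity of \<open>b\<close>.\<close>

lemma carrier_decomposition: "carrier G = rotations \<union> (reflections True \<union> reflections False)"
proof
  show "carrier G \<subseteq> rotations \<union> (reflections True \<union> reflections False)"
  proof
    fix g assume "g \<in> carrier G"
    then obtain a b :: nat where g: "g = x [^] a \<otimes> y [^] b" using normal_form by blast
    define z where "z = (y \<otimes> y) [^] (b div 2)"
    have z: "z \<in> centre G"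
      using pow_centre[OF y_square, of "int (b div 2)"] by (simp only: z_def int_pow_int)
    then have [simp]: "z \<in> carrier G" by (rule centreD)
    have yz: "y [^] (2 * (b div 2)) = z"
      using nat_pow_pow[OF y, of 2 "b div 2"] by (simp add: z_def numeral_2_eq_2)
    show "g \<in> rotations \<union> (reflections True \<union> reflections False)"
    proof (cases "even b")
      case True
      then have "g = x [^] int a \<otimes> z" using yz by (simp add: g int_pow_int)
      then show ?thesis using z by (auto simp: rotations_def)
    next
      case False
      then have "y [^] b = z \<otimes> y" using yz by (metis nat_pow_Suc odd_two_times_div_two_succ Suc_eq_plus1)
      then have "g = x [^] int a \<otimes> z \<otimes> y" by (simp add: g int_pow_int m_assoc)
      then show ?thesis using z unfolding reflections_def by blast
    qed
  qed
qed (auto simp: rotations_carrier reflections_carrier)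

lemma rotation_mult_reflection:
  assumes "g \<in> reflections p" "z \<in> centre G"
  shows "x [^] (i::int) \<otimes> z \<otimes> g \<in> reflections (p = even i)"
proof -
  obtain j w where g: "g = x [^] (j::int) \<otimes> w \<otimes> y" and w: "w \<in> centre G" and p: "even j = p"
    using assms(1) unfolding reflections_def by blast
  have [simp]: "w \<in> carrier G" "z \<in> carrier G" using w assms(2) by (auto simp: centreD)
  have "x [^] i \<otimes> z \<otimes> g = x [^] i \<otimes> (z \<otimes> x [^] j) \<otimes> w \<otimes> y" by (simp add: g m_assoc)
  also have "z \<otimes> x [^] j = x [^] j \<otimes> z" by (rule centre_comm[OF assms(2)]) simp
  finally have "x [^] i \<otimes> z \<otimes> g = x [^] (i + j) \<otimes> (z \<otimes> w) \<otimes> y"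
    by (simp add: int_pow_mult m_assoc)
  moreover have "even (i + j) = (p = even i)" using p by auto
  ultimately show ?thesis
    unfolding reflections_def using centre_closed(1)[OF assms(2) w] by blast
qed

text \<open>Used to compare two reflections: in \<open>h g^(-1)\<close> the factors \<open>y\<close>
  cancel and the exponents of \<open>x\<close> subtract, so the parity of the difference tells
  whether \<open>p = q\<close>.\<close>

lemma reflection_ratio:
  assumes "g \<in> reflections p" "h \<in> reflections q"
  obtains i z where "z \<in> centre G" "h = x [^] (i::int) \<otimes> z \<otimes> g" "even i \<longleftrightarrow> p = q"
proof -
  obtain j w where g: "g = x [^] (j::int) \<otimes> w \<otimes> y" and w: "w \<in> centre G" and p: "even j = p"
    using assms(1) unfolding reflections_def by blast
  obtain k v where h: "h = x [^] (k::int) \<otimes> v \<otimes> y" and v: "v \<in> centre G" and q: "even k = q"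
    using assms(2) unfolding reflections_def by blast
  define z where "z = v \<otimes> inv w"
  have z: "z \<in> centre G" using v w by (simp add: z_def centre_closed)
  have [simp]: "w \<in> carrier G" "v \<in> carrier G" "z \<in> carrier G"
    using w v z by (auto simp: centreD)
  have "x [^] (k - j) \<otimes> z \<otimes> g = x [^] (k - j) \<otimes> (z \<otimes> x [^] j) \<otimes> w \<otimes> y"
    by (simp add: g m_assoc)
  also have "z \<otimes> x [^] j = x [^] j \<otimes> z" by (rule centre_comm[OF z]) simp
  also have "x [^] (k - j) \<otimes> (x [^] j \<otimes> z) \<otimes> w \<otimes> y = x [^] (k - j + j) \<otimes> (z \<otimes> w) \<otimes> y"
    unfolding int_pow_mult[OF x] by (simp add: m_assoc)
  also have "z \<otimes> w = v" by (simp add: z_def m_assoc)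
  finally have "h = x [^] (k - j) \<otimes> z \<otimes> g" by (simp add: h)
  then show ?thesis using that z p q by auto
qed

text \<open>This is \<open>reflection_x_pow\<close> with \<open>-i\<close> for \<open>i\<close>,
  read from right to left. It turns a rotation on the left of \<open>g\<close> into one on the
  right, and so also shows how \<open>g\<close> conjugates rotations.\<close>

lemma rotation_reflection_swap:
  assumes g: "g \<in> reflections p" and z: "z \<in> centre G"
  shows "x [^] (i::int) \<otimes> z \<otimes> g = g \<otimes> (x [^] (-i) \<otimes> (c [^] i \<otimes> z))"
proof -
  define w where "w = c [^] i \<otimes> z"
  have w: "w \<in> centre G" using z by (simp add: w_def centre_closed)
  have [simp]: "w \<in> carrier G" "z \<in> carrier G" "g \<in> carrier G"
    using w z g by (auto simp: centreD reflections_carrier)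
  have "g \<otimes> (x [^] (-i) \<otimes> w) = x [^] i \<otimes> c [^] (-i) \<otimes> (g \<otimes> w)"
    using reflection_x_pow[OF g, of "-i"] by (simp flip: m_assoc)
  also have "g \<otimes> w = w \<otimes> g" using centre_comm[OF w] by simp
  also have "c [^] (-i) \<otimes> w = z" by (simp add: w_def int_pow_neg inv_cancel_left)
  then have "x [^] i \<otimes> c [^] (-i) \<otimes> (w \<otimes> g) = x [^] i \<otimes> z \<otimes> g"
    by (simp add: m_assoc flip: m_assoc[of "c [^] (-i)"])
  finally show ?thesis by (simp add: w_def)
qed

lemma rotations_comm:
  assumes "a \<in> rotations" "b \<in> rotations"
  shows "a \<otimes> b = b \<otimes> a"
proof -
  obtain i z where a: "a = x [^] (i::int) \<otimes> z" and z: "z \<in> centre G"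
    using assms(1) unfolding rotations_def by blast
  obtain j w where b: "b = x [^] (j::int) \<otimes> w" and w: "w \<in> centre G"
    using assms(2) unfolding rotations_def by blast
  have [simp]: "z \<in> carrier G" "w \<in> carrier G" using z w by (auto simp: centreD)
  have "a \<otimes> b = x [^] i \<otimes> (z \<otimes> (x [^] j \<otimes> w))" by (simp add: a b m_assoc)
  also have "z \<otimes> (x [^] j \<otimes> w) = x [^] j \<otimes> w \<otimes> z" by (rule centre_comm[OF z]) simp
  also have "x [^] i \<otimes> (x [^] j \<otimes> w \<otimes> z) = x [^] j \<otimes> (x [^] i \<otimes> w) \<otimes> z"
    using x_pow_comm[of i j] by (simp flip: m_assoc)
  also have "x [^] i \<otimes> w = w \<otimes> x [^] i" using centre_comm[OF w] by simp
  finally show ?thesis by (simp add: a b m_assoc)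
qed

section \<open>Conjugacy classes of reflections and rotations\<close>

lemma conj_by_rotation:
  assumes g: "g \<in> reflections p" and z: "z \<in> centre G"
  shows "inv (x [^] (i::int) \<otimes> z) \<otimes> g \<otimes> (x [^] i \<otimes> z) = u [^] i \<otimes> g"
proof -
  have [simp]: "z \<in> carrier G" "g \<in> carrier G" "c [^] i \<in> carrier G"
    using g z by (auto simp: centreD reflections_carrier)
  have "inv (x [^] i \<otimes> z) \<otimes> g \<otimes> (x [^] i \<otimes> z) = inv z \<otimes> (x [^] (-i) \<otimes> (g \<otimes> x [^] i)) \<otimes> z"
    by (simp add: inv_mult_group m_assoc int_pow_neg)
  also have "g \<otimes> x [^] i = x [^] (-i) \<otimes> c [^] i \<otimes> g" by (rule reflection_x_pow[OF g])
  \<comment> \<open>One factor \<open>x^(-i)\<close> comes from the inverse of the rotation, the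
    other from moving \<open>x^i\<close> past \<open>g\<close>; together they give the exponent
    \<open>-2 i\<close> of \<open>u_pow\<close>.\<close>
  also have "x [^] (-i) \<otimes> (x [^] (-i) \<otimes> c [^] i \<otimes> g) = x [^] (-i + -i) \<otimes> c [^] i \<otimes> g"
    unfolding int_pow_mult[OF x] by (simp add: m_assoc)
  also have "\<dots> = u [^] i \<otimes> g" by (simp add: u_pow)
  also have "inv z \<otimes> (u [^] i \<otimes> g) \<otimes> z = inv z \<otimes> (z \<otimes> (u [^] i \<otimes> g))"
    using centre_comm[OF z, of "u [^] i \<otimes> g"] by (simp add: m_assoc)
  finally show ?thesis by (simp add: inv_cancel_left)
qed

text \<open>Conjugating by a rotation multiplies \<open>g\<close> by a power of \<open>u\<close>. A
  reflection \<open>h\<close> gives nothing new: \<open>h = g a\<close> with a rotation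
  \<open>a\<close>, and \<open>g\<close> commutes with itself, so \<open>h\<close> and
  \<open>a\<close> conjugate \<open>g\<close> alike.\<close>

lemma conj_class_reflection:
  assumes g: "g \<in> reflections p"
  shows "conj_class G g = {u [^] (i::int) \<otimes> g | i. True}"
proof
  have [simp]: "g \<in> carrier G" using g by (rule reflections_carrier)
  show "conj_class G g \<subseteq> {u [^] (i::int) \<otimes> g | i. True}"
  proof
    fix k assume "k \<in> conj_class G g"
    then obtain h where h: "h \<in> carrier G" and k: "k = inv h \<otimes> g \<otimes> h"
      by (auto simp: conj_class_def)
    consider i z where "z \<in> centre G" "h = x [^] (i::int) \<otimes> z" | q where "h \<in> reflections q"
      using h carrier_decomposition by (auto simp: rotations_def)
    then show "k \<in> {u [^] (i::int) \<otimes> g | i. True}"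
    proof cases
      case 1
      then show ?thesis using conj_by_rotation[OF g] k by blast
    next
      case 2
      then obtain i z where z: "z \<in> centre G" and h': "h = x [^] (i::int) \<otimes> z \<otimes> g"
        using reflection_ratio[OF g] by metis
      define w where "w = c [^] i \<otimes> z"
      have w: "w \<in> centre G" using z by (simp add: w_def centre_closed)
      have [simp]: "w \<in> carrier G" using w by (rule centreD)
      define a where "a = x [^] (-i) \<otimes> w"
      have [simp]: "a \<in> carrier G" by (simp add: a_def)
      have "h = g \<otimes> a" using rotation_reflection_swap[OF g z] h' by (simp add: a_def w_def)
      then have "k = inv a \<otimes> g \<otimes> a" by (simp add: k inv_mult_group m_assoc inv_cancel_left)
      then show ?thesis using conj_by_rotation[OF g w] by (auto simp: a_def)
    qed
  qed
  show "{u [^] (i::int) \<otimes> g | i. True} \<subseteq> conj_class G g"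
  proof clarify
    fix i :: int
    have "u [^] i \<otimes> g = inv (x [^] i \<otimes> \<one>) \<otimes> g \<otimes> (x [^] i \<otimes> \<one>)"
      by (rule conj_by_rotation[OF g, symmetric]) (simp add: centre_closed)
    then show "u [^] i \<otimes> g \<in> conj_class G g"
      unfolding conj_class_def by (intro CollectI exI[of _ "x [^] i \<otimes> \<one>"]) simp
  qed
qed

text \<open>Powers of \<open>u\<close> contain \<open>x\<close> to the even exponent
  \<open>-2 i\<close>, so conjugation keeps the parity.\<close>

lemma conj_class_reflection_subset:
  assumes "g \<in> reflections p"
  shows "conj_class G g \<subseteq> reflections p"
proof -
  have "u [^] i \<otimes> g \<in> reflections p" for i :: int
    using rotation_mult_reflection[OF assms c_pow[of i], of "-2 * i"] by (simp add: u_pow)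
  then show ?thesis by (auto simp: conj_class_reflection[OF assms])
qed

lemma card_conj_class_reflection:
  assumes g: "g \<in> reflections p"
  shows "card (conj_class G g) = ord u"
proof -
  have "conj_class G g = (\<lambda>h. h \<otimes> g) ` generate G {u}"
    by (auto simp: conj_class_reflection[OF g] generate_pow)
  moreover have "inj_on (\<lambda>h. h \<otimes> g) (generate G {u})"
    using reflections_carrier[OF g] generate_in_carrier[of "{u}"]
    by (intro inj_onI) (metis empty_subsetI insert_subset r_cancel u_carrier)
  ultimately show ?thesis
    using generate_pow_card[OF u_carrier] by (simp add: card_image)
qed

text \<open>Rotations commute with one another, while all reflections conjugate a given rotation to
  one and the same element.\<close>

lemma conj_class_rotation:
  assumes z: "z \<in> centre G"
  shows "conj_class G (x [^] (i::int) \<otimes> z) = {x [^] i \<otimes> z, x [^] (-i) \<otimes> (c [^] i \<otimes> z)}"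
proof
  define a where "a = x [^] i \<otimes> z"
  define b where "b = x [^] (-i) \<otimes> (c [^] i \<otimes> z)"
  have [simp]: "z \<in> carrier G" using z by (rule centreD)
  have [simp]: "a \<in> carrier G" "b \<in> carrier G" by (simp_all add: a_def b_def)
  have a: "a \<in> rotations" using z by (auto simp: a_def rotations_def)
  have conj: "inv h \<otimes> a \<otimes> h = b" if "h \<in> reflections q" for h q
  proof -
    have "inv h \<otimes> (a \<otimes> h) = inv h \<otimes> (h \<otimes> b)"
      using rotation_reflection_swap[OF that z, of i] by (simp add: a_def b_def)
    then show ?thesis using reflections_carrier[OF that] by (simp add: m_assoc inv_cancel_left)
  qed
  show "conj_class G (x [^] i \<otimes> z) \<subseteq> {x [^] i \<otimes> z, x [^] (-i) \<otimes> (c [^] i \<otimes> z)}"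
    unfolding a_def[symmetric] b_def[symmetric]
  proof
    fix k assume "k \<in> conj_class G a"
    then obtain h where h: "h \<in> carrier G" and k: "k = inv h \<otimes> a \<otimes> h"
      by (auto simp: conj_class_def)
    show "k \<in> {a, b}"
    proof (cases "h \<in> rotations")
      case True
      then have "k = inv h \<otimes> (h \<otimes> a)" using rotations_comm[OF a True] h by (simp add: k m_assoc)
      then show ?thesis using h by (simp add: inv_cancel_left)
    next
      case False
      then show ?thesis using conj h k carrier_decomposition by auto
    qed
  qed
  have "b \<in> conj_class G a"
    unfolding conj_class_def using conj[OF y_reflection] by (intro CollectI exI[of _ y]) simp
  then show "{x [^] i \<otimes> z, x [^] (-i) \<otimes> (c [^] i \<otimes> z)} \<subseteq> conj_class G (x [^] i \<otimes> z)"
    using conj_class_self[of a] by (simp add: a_def b_def)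
qed

lemma rotation_central_iff:
  assumes z: "z \<in> centre G"
  shows "x [^] (i::int) \<otimes> z \<in> centre G \<longleftrightarrow> int (ord u) dvd i"
proof -
  have [simp]: "z \<in> carrier G" using z by (rule centreD)
  have "x [^] i \<otimes> z \<in> centre G \<longleftrightarrow> x [^] i \<in> centre G"
  proof
    assume "x [^] i \<otimes> z \<in> centre G"
    then have "x [^] i \<otimes> z \<otimes> inv z \<in> centre G" using z by (simp only: centre_closed)
    then show "x [^] i \<in> centre G" by (simp add: m_assoc)
  qed (simp add: centre_closed z)
  then show ?thesis by (simp add: x_pow_centre_iff)
qed

lemma conj_class_rotation_subset:
  assumes "a \<in> rotations - centre G"
  shows "conj_class G a \<subseteq> rotations - centre G"
proof -
  obtain i z where a: "a = x [^] (i::int) \<otimes> z" and z: "z \<in> centre G"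
    using assms unfolding rotations_def by blast
  have "x [^] (-i) \<otimes> (c [^] i \<otimes> z) \<in> rotations"
    unfolding rotations_def using centre_closed(1)[OF c_pow z] by blast
  moreover have "x [^] (-i) \<otimes> (c [^] i \<otimes> z) \<notin> centre G"
    using assms rotation_central_iff[OF z, of i]
      rotation_central_iff[OF centre_closed(1)[OF c_pow z], of "-i" i] by (simp add: a)
  ultimately show ?thesis
    using assms unfolding a conj_class_rotation[OF z] by blast
qed

text \<open>The two members of the class agree only if \<open>u^i = 1\<close>, which would make the
  rotation central.\<close>

lemma card_conj_class_rotation:
  assumes "a \<in> rotations - centre G"
  shows "card (conj_class G a) = 2"
proof -
  obtain i z where a: "a = x [^] (i::int) \<otimes> z" and z: "z \<in> centre G"
    using assms unfolding rotations_def by blast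
  have [simp]: "z \<in> carrier G" using z by (rule centreD)
  have "\<not> int (ord u) dvd i" using assms rotation_central_iff[OF z, of i] by (simp add: a)
  then have "x [^] (-i) \<otimes> c [^] i \<noteq> x [^] i"
    using u_pow_eq_one[of i] int_pow_eq_id[of u i] by auto
  then have "x [^] (-i) \<otimes> (c [^] i \<otimes> z) \<noteq> x [^] i \<otimes> z"
    by (simp flip: m_assoc)
  then show ?thesis by (simp add: a conj_class_rotation[OF z] card_insert_if)
qed

text \<open>Since \<open>x^i\<close> is central exactly for the multiples \<open>i\<close> of
  \<open>ord u\<close>, each rotation is \<open>x^i z\<close> for a unique \<open>i\<close> with
  \<open>0 <= i < ord u\<close> and a unique central \<open>z\<close>.\<close>

lemma card_rotations: "card rotations = ord u * card (centre G)"
proof -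
  have fin: "finite (centre G)"
    using finite_carrier by (rule finite_subset[rotated]) (auto simp: centre_def)
  have pos: "ord u > 0" using ord_ge_1[OF finite_carrier u_carrier] by simp
  let ?f = "\<lambda>(i::int, z). x [^] i \<otimes> z"
  have "inj_on ?f ({0..<int (ord u)} \<times> centre G)"
  proof (rule inj_onI, clarify)
    fix i j z w
    assume i: "i \<in> {0..<int (ord u)}" and j: "j \<in> {0..<int (ord u)}"
      and z: "z \<in> centre G" and w: "w \<in> centre G" and eq: "x [^] i \<otimes> z = x [^] j \<otimes> w"
    have [simp]: "z \<in> carrier G" "w \<in> carrier G" using z w by (auto simp: centreD)
    have "x [^] (i - j) \<otimes> z = x [^] (-j) \<otimes> (x [^] i \<otimes> z)"
      using int_pow_mult[OF x, of "-j" i] by (simp flip: m_assoc)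
    also have "\<dots> = w" unfolding eq by (simp add: int_pow_neg inv_cancel_left)
    finally have "x [^] (i - j) \<otimes> z \<in> centre G" using w by simp
    then have "int (ord u) dvd i - j" using rotation_central_iff[OF z] by simp
    then have "i = j" using i j by (auto dest: zdvd_imp_le simp: mod_eq_dvd_iff[symmetric])
    then show "i = j \<and> z = w" using eq by simp
  qed
  moreover have "?f ` ({0..<int (ord u)} \<times> centre G) = rotations"
  proof
    show "?f ` ({0..<int (ord u)} \<times> centre G) \<subseteq> rotations"
      by (auto simp: rotations_def)
    show "rotations \<subseteq> ?f ` ({0..<int (ord u)} \<times> centre G)"
    proof
      fix a assume "a \<in> rotations"
      then obtain i z where a: "a = x [^] (i::int) \<otimes> z" and z: "z \<in> centre G"
        unfolding rotations_def by blast
      have [simp]: "z \<in> carrier G" using z by (rule centreD)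
      define q r where "q = int (ord u) * (i div int (ord u))" and "r = i mod int (ord u)"
      have "i = r + q" by (simp add: q_def r_def)
      then have "a = x [^] r \<otimes> (x [^] q \<otimes> z)" by (simp add: a int_pow_mult m_assoc)
      moreover have "x [^] q \<otimes> z \<in> centre G" by (simp add: rotation_central_iff[OF z] q_def)
      moreover have "r \<in> {0..<int (ord u)}" using pos by (simp add: r_def)
      ultimately show "a \<in> ?f ` ({0..<int (ord u)} \<times> centre G)" by force
    qed
  qed
  ultimately show ?thesis
    using card_image[of ?f "{0..<int (ord u)} \<times> centre G"] by (simp add: card_cartesian_product)
qed

end

text \<open>A reflection determines the exponent of \<open>x\<close> only modulo
  \<open>ord u\<close>, since the central factor absorbs multiples of \<open>ord u\<close>. For even
  \<open>ord u\<close> the parity is therefore well defined, and the reflection classes fall into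
  two parts of the graph.\<close>

locale even_dihedral_mod_centre = dihedral_mod_centre +
  assumes even_ord: "even (ord u)"
begin

text \<open>A common element would be a reflection commuting with the rotation \<open>x\<close>,
  forcing \<open>ord u\<close> to divide 1.\<close>

lemma rotations_reflections_disjoint: "rotations \<inter> reflections p = {}"
proof -
  have False if "g \<in> rotations" "g \<in> reflections p" for g
  proof -
    have "x \<in> rotations"
      unfolding rotations_def
      by (rule CollectI, rule exI[of _ 1], rule exI[of _ \<one>]) (simp add: centre_closed)
    then have "x [^] (1::int) \<otimes> \<one> \<otimes> g = g \<otimes> (x [^] (1::int) \<otimes> \<one>)"
      using rotations_comm[OF _ that(1)] by simp
    then have "int (ord u) dvd 1"
      using commutes_reflection_iff[OF that(2), of \<one> 1] by (simp add: centre_closed)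
    then show False using even_ord by simp
  qed
  then show ?thesis by blast
qed

text \<open>Comparing a common element with itself gives an odd \<open>i\<close> with
  \<open>x^i z = 1\<close>, which the even number \<open>ord u\<close> would have to divide.\<close>

lemma reflections_disjoint: "reflections True \<inter> reflections False = {}"
proof -
  have False if T: "g \<in> reflections True" and F: "g \<in> reflections False" for g
  proof -
    obtain i z where z: "z \<in> centre G" and g: "g = x [^] (i::int) \<otimes> z \<otimes> g" and i: "odd i"
      using reflection_ratio[OF T F] by metis
    have [simp]: "z \<in> carrier G" "g \<in> carrier G"
      using z T by (auto simp: centreD reflections_carrier)
    have "x [^] i \<otimes> z = \<one>" using g by (metis \<open>g \<in> carrier G\<close> \<open>z \<in> carrier G\<close> int_pow_closed m_closed r_cancel_one' x)
    then have "int (ord u) dvd i" using rotation_central_iff[OF z, of i] by (simp add: centre_closed)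
    then show False using even_ord i by (metis dvd_trans even_of_nat)
  qed
  then show ?thesis by blast
qed

lemma centre_subset_rotations: "centre G \<subseteq> rotations"
proof
  fix z assume z: "z \<in> centre G"
  then show "z \<in> rotations"
    unfolding rotations_def
    by (intro CollectI exI[of _ 0] exI[of _ z]) (simp add: centreD)
qed

lemma finite_reflections: "finite (reflections p)"
  using finite_carrier by (rule finite_subset[rotated]) (auto simp: reflections_carrier)

lemma finite_rotations: "finite rotations"
  using finite_carrier by (rule finite_subset[rotated]) (auto simp: rotations_carrier)

text \<open>Left multiplication by \<open>x\<close> flips the parity and injects each half into the
  other, so the halves are equally large. Right multiplication by \<open>y\<close> maps the
  rotations bijectively onto their union.\<close>

lemma card_reflections: "2 * card (reflections p) = card rotations"
proof -
  have le: "card (reflections p) \<le> card (reflections (\<not> p))" for p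
  proof (rule card_inj_on_le)
    show "inj_on (\<lambda>g. x \<otimes> g) (reflections p)"
      by (intro inj_onI) (metis l_cancel reflections_carrier x)
    show "(\<lambda>g. x \<otimes> g) ` reflections p \<subseteq> reflections (\<not> p)"
      using rotation_mult_reflection[of _ p \<one> 1] by (auto simp: centre_closed)
  qed (rule finite_reflections)
  have eq: "card (reflections p) = card (reflections (\<not> p))"
    using le[of p] le[of "\<not> p"] by simp
  have "card rotations = card ((\<lambda>g. g \<otimes> y) ` rotations)"
    by (intro card_image[symmetric] inj_onI) (metis r_cancel rotations_carrier y)
  also have "(\<lambda>g. g \<otimes> y) ` rotations = reflections True \<union> reflections False"
    unfolding rotations_def reflections_def by blast
  also have "card \<dots> = card (reflections True) + card (reflections False)"
    by (rule card_Un_disjoint[OF finite_reflections finite_reflections reflections_disjoint])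
  finally show ?thesis using eq by (cases p) auto
qed

text \<open>The parts of the graph are \<open>C\<close>, the classes of non-central rotations, and
  the two sets \<open>R True\<close> and \<open>R False\<close> of reflection classes. The
  tripartite criterion applies with \<open>k = ord u - 1\<close>.\<close>

theorem nccc_Q_integral_iff: "nccc_Q_integral G \<longleftrightarrow> ord u = 2"
proof -
  define n where "n = card (conj_class G ` reflections True)"
  define C where "C = conj_class G ` (rotations - centre G)"
  define R where "R p = conj_class G ` reflections p" for p
  have pos: "ord u > 0" using ord_ge_1[OF finite_carrier u_carrier] by simp
  have ge2: "ord u \<ge> 2" using pos even_ord by (cases "ord u") (auto, presburger)
  have sR: "ord u * card (R p) = card (reflections p)" for p
    unfolding R_def
    by (rule card_conj_classes)
      (use finite_reflections reflections_carrier conj_class_reflection_subset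
        card_conj_class_reflection in auto)
  have sC: "2 * card C = card (rotations - centre G)"
    unfolding C_def
    by (rule card_conj_classes)
      (use finite_rotations rotations_carrier conj_class_rotation_subset
        card_conj_class_rotation in auto)
  have fin: "finite (centre G)" using centre_subset_rotations finite_rotations by (rule finite_subset)
  \<comment> \<open>A reflection class has \<open>ord u\<close> elements and each half has half as
    many elements as there are rotations. So \<open>ord u\<close> cancels, and either half consists
    of \<open>|Z(G)| / 2\<close> classes.\<close>
  have "ord u * (2 * card (R p)) = ord u * card (centre G)" for p
    using sR[of p] card_reflections[of p] card_rotations by (simp only: mult.left_commute)
  then have Z: "2 * card (R p) = card (centre G)" for p
    using pos by simp
  then have n: "card (R p) = n" for p
    using Z[of p] Z[of True] unfolding n_def R_def by linarith
  have Zn: "card (centre G) = 2 * n" using Z[of True] n by simp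
  have "2 * card C = 2 * (n * (ord u - 1))"
    using sC fin centre_subset_rotations
    by (simp add: card_Diff_subset card_rotations Zn algebra_simps)
  then have cardC: "card C = n * (ord u - 1)" by simp
  have "\<one> \<in> centre G" by (rule centre_closed)
  then have npos: "n > 0" using Zn fin by (metis card_gt_0_iff empty_iff nat_0_less_mult_iff)

  have V: "nccc_vertices G = C \<union> R True \<union> R False"
  proof -
    have "carrier G - centre G = (rotations - centre G) \<union> (reflections True \<union> reflections False)"
      using carrier_decomposition rotations_reflections_disjoint centre_subset_rotations by blast
    then show ?thesis by (auto simp: nccc_vertices_def C_def R_def)
  qed
  have inC: "A \<noteq> {} \<and> A \<subseteq> rotations - centre G" if "A \<in> C" for A
    using that conj_class_rotation_subset rotations_carrier conj_class_self unfolding C_def by blast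
  have inR: "A \<noteq> {} \<and> A \<subseteq> reflections p" if "A \<in> R p" for A p
    using that conj_class_reflection_subset reflections_carrier conj_class_self unfolding R_def by blast
  have CR: "C \<inter> R p = {}" for p
    using inC inR rotations_reflections_disjoint by blast
  have RR: "R True \<inter> R False = {}"
    using inR reflections_disjoint by blast

  \<comment> \<open>Adjacency demands that no pair of representatives commutes, so one commuting
    pair for any two classes of the same part excludes an edge.\<close>
  have CC_comm: "\<exists>a\<in>A. \<exists>b\<in>B. a \<otimes> b = b \<otimes> a" if "A \<in> C" "B \<in> C" for A B
    using inC[OF that(1)] inC[OF that(2)] rotations_comm by blast
  have RR_comm: "\<exists>a\<in>A. \<exists>b\<in>B. a \<otimes> b = b \<otimes> a" if AB: "A \<in> R p" "B \<in> R p" for A B p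
  proof -
    obtain g h where g: "g \<in> reflections p" and A: "A = conj_class G g"
      and h: "h \<in> reflections p" and B: "B = conj_class G h"
      using AB unfolding R_def by blast
    obtain i z where z: "z \<in> centre G" and hg: "h = x [^] (i::int) \<otimes> z \<otimes> g" and "even i"
      using reflection_ratio[OF g h] by metis
    \<comment> \<open>The conjugate \<open>u^(-j) g\<close> of \<open>g\<close> contains the same
      power \<open>x^(2 j)\<close> as \<open>h\<close>, so the two differ by a central factor and
      commute.\<close>
    then obtain j where i: "i = 2 * j" by blast
    define a where "a = u [^] (-j) \<otimes> g"
    define w where "w = c [^] j \<otimes> z"
    have w: "w \<in> centre G" using z by (simp add: w_def centre_closed)
    have [simp]: "w \<in> carrier G" "g \<in> carrier G" "z \<in> carrier G"
      using w g z by (auto simp: centreD reflections_carrier)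
    have [simp]: "a \<in> carrier G" by (simp add: a_def)
    have "a = x [^] i \<otimes> c [^] (-j) \<otimes> g" by (simp add: a_def u_pow i)
    then have "a \<otimes> w = x [^] i \<otimes> c [^] (-j) \<otimes> (g \<otimes> w)" by (simp add: m_assoc)
    also have "g \<otimes> w = w \<otimes> g" using centre_comm[OF w] by simp
    also have "x [^] i \<otimes> c [^] (-j) \<otimes> (w \<otimes> g) = x [^] i \<otimes> (c [^] (-j) \<otimes> w) \<otimes> g"
      by (simp add: m_assoc)
    also have "c [^] (-j) \<otimes> w = z" by (simp add: w_def int_pow_neg inv_cancel_left)
    finally have "h = a \<otimes> w" by (simp add: hg)
    then have "a \<otimes> h = h \<otimes> a" using centre_comm[OF w, of a] by (simp add: m_assoc)
    moreover have "a \<in> A" unfolding A conj_class_reflection[OF g] a_def by blast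
    moreover have "h \<in> B" using reflections_carrier[OF h] conj_class_self by (simp add: B)
    ultimately show ?thesis by blast
  qed
  have CR_nc: "a \<otimes> b \<noteq> b \<otimes> a" if ab: "a \<in> rotations - centre G" "b \<in> reflections p" for a b p
  proof -
    obtain i z where a: "a = x [^] (i::int) \<otimes> z" and z: "z \<in> centre G"
      using ab(1) unfolding rotations_def by blast
    then show ?thesis
      using commutes_reflection_iff[OF ab(2) z, of i] rotation_central_iff[OF z, of i] ab(1) by simp
  qed
  have RR_nc: "a \<otimes> b \<noteq> b \<otimes> a" if ab: "a \<in> reflections True" "b \<in> reflections False" for a b
  proof
    assume comm: "a \<otimes> b = b \<otimes> a"
    obtain i z where z: "z \<in> centre G" and b: "b = x [^] (i::int) \<otimes> z \<otimes> a" and i: "odd i"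
      using reflection_ratio[OF ab] by metis
    have [simp]: "z \<in> carrier G" "a \<in> carrier G"
      using z ab by (auto simp: centreD reflections_carrier)
    \<comment> \<open>With \<open>b = r a\<close> for the rotation \<open>r = x^i z\<close>,
      commuting reads \<open>r a a = a r a\<close>. Cancelling \<open>a\<close> leaves
      \<open>r\<close> commuting with \<open>a\<close>, although \<open>i\<close> is odd.\<close>
    have "x [^] i \<otimes> z \<otimes> a \<otimes> a = a \<otimes> (x [^] i \<otimes> z) \<otimes> a"
      using comm by (simp add: b m_assoc)
    then have "x [^] i \<otimes> z \<otimes> a = a \<otimes> (x [^] i \<otimes> z)" by simp
    then have "int (ord u) dvd i" using commutes_reflection_iff[OF ab(1) z] by simp
    then show False using even_ord i by (metis dvd_trans even_of_nat)
  qed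

  have adj: "nccc_adj G A B \<longleftrightarrow>
      \<not> (A \<in> C \<and> B \<in> C \<or> A \<in> R True \<and> B \<in> R True \<or> A \<in> R False \<and> B \<in> R False)"
    if "A \<in> nccc_vertices G" "B \<in> nccc_vertices G" for A B
  proof
    assume "nccc_adj G A B"
    then show "\<not> (A \<in> C \<and> B \<in> C \<or> A \<in> R True \<and> B \<in> R True \<or> A \<in> R False \<and> B \<in> R False)"
      using CC_comm RR_comm unfolding nccc_adj_def by blast
  next
    assume *: "\<not> (A \<in> C \<and> B \<in> C \<or> A \<in> R True \<and> B \<in> R True \<or> A \<in> R False \<and> B \<in> R False)"
    then have "A \<noteq> B" using that V by blast
    moreover have "a \<otimes> b \<noteq> b \<otimes> a" if "a \<in> A" "b \<in> B" for a b
    proof -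
      consider "A \<in> C" "B \<in> R True \<union> R False" | "B \<in> C" "A \<in> R True \<union> R False"
        | "A \<in> R True" "B \<in> R False" | "A \<in> R False" "B \<in> R True"
        using * \<open>A \<in> nccc_vertices G\<close> \<open>B \<in> nccc_vertices G\<close> V by blast
      then show ?thesis
      proof cases
        case 1 then show ?thesis using CR_nc inC inR \<open>a \<in> A\<close> \<open>b \<in> B\<close> by blast
      next
        case 2 then show ?thesis using CR_nc[of b a] inC inR \<open>a \<in> A\<close> \<open>b \<in> B\<close> by fastforce
      next
        case 3 then show ?thesis using RR_nc inR \<open>a \<in> A\<close> \<open>b \<in> B\<close> by blast
      next
        case 4 then show ?thesis using RR_nc[of b a] inR \<open>a \<in> A\<close> \<open>b \<in> B\<close> by fastforce
      qed
    qed
    ultimately show "nccc_adj G A B" using that unfolding nccc_adj_def by blast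
  qed

  have "Q_integral (nccc_vertices G) (nccc_adj G) \<longleftrightarrow> ord u - 1 = 1"
  proof (rule Q_integral_complete_tripartite_iff[OF _ V])
    show "finite (nccc_vertices G)" using finite_carrier by (simp add: nccc_vertices_def)
  qed (use CR RR cardC n npos ge2 adj in auto)
  then show ?thesis using ge2 by (auto simp: nccc_Q_integral_def)
qed

end

section \<open>The five families\<close>

context group
begin

lemma centreI_generate:
  assumes gen: "generate G {x, y} = carrier G" and z: "z \<in> carrier G"
    and x: "x \<in> carrier G" "z \<otimes> x = x \<otimes> z" and y: "y \<in> carrier G" "z \<otimes> y = y \<otimes> z"
  shows "z \<in> centre G"
proof -
  have inv_comm: "z \<otimes> inv h = inv h \<otimes> z" if h: "h \<in> carrier G" and "z \<otimes> h = h \<otimes> z" for h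
  proof -
    have "z \<otimes> inv h = inv h \<otimes> (h \<otimes> z) \<otimes> inv h" using h z by (simp add: inv_cancel_left)
    also have "\<dots> = inv h \<otimes> (z \<otimes> h) \<otimes> inv h" using that by simp
    also have "\<dots> = inv h \<otimes> z" using h z by (simp add: m_assoc)
    finally show ?thesis .
  qed
  have "z \<otimes> g = g \<otimes> z" if "g \<in> generate G {x, y}" for g
    using that
  proof (induction rule: generate.induct)
    case one
    then show ?case using z by simp
  next
    case (incl h)
    then show ?case using x y by auto
  next
    case (inv h)
    then show ?case using inv_comm x y by auto
  next
    case (eng h1 h2)
    then have h: "h1 \<in> carrier G" "h2 \<in> carrier G" using gen by auto
    have "z \<otimes> (h1 \<otimes> h2) = h1 \<otimes> z \<otimes> h2" using h z eng.IH(1) by (simp flip: m_assoc)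
    also have "\<dots> = h1 \<otimes> h2 \<otimes> z" using h z eng.IH(2) by (simp add: m_assoc)
    finally show ?case .
  qed
  then show ?thesis using z gen by (auto simp: centre_def)
qed

text \<open>The words \<open>x^i y^j\<close> are closed under left multiplication by
  \<open>x\<close> and, through \<open>rel\<close>, by \<open>y\<close>, hence under products;
  finiteness makes inverses of the generators powers. An arbitrary odd \<open>t\<close> covers both
  \<open>t = 1\<close> and the exponent 3 arising for V.\<close>

lemma generate_normal_form:
  assumes fin: "finite (carrier G)" and gen: "generate G {x, y} = carrier G"
    and x [simp]: "x \<in> carrier G" and y [simp]: "y \<in> carrier G"
    and yy: "y \<otimes> y \<in> centre G" and rel: "y \<otimes> x = x [^] (s::nat) \<otimes> y [^] (t::nat)" and t: "odd t"
    and g: "g \<in> carrier G"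
  shows "\<exists>(i::nat) (j::nat). g = x [^] i \<otimes> y [^] j"
proof -
  define S where "S = {x [^] (i::nat) \<otimes> y [^] (j::nat) | i j. True}"
  obtain q where q: "t = Suc (2 * q)" using t by (auto elim: oddE)
  define w where "w = (y \<otimes> y) [^] q"
  have w: "w \<in> centre G"
    using subgroup_int_pow_closed[OF subgroup_centre yy, of "int q"] by (simp only: w_def int_pow_int)
  then have [simp]: "w \<in> carrier G" by (rule centreD)
  have wy: "y [^] (2 * q) = w"
    using nat_pow_pow[OF y, of 2 q] by (simp add: w_def numeral_2_eq_2)
  have yt: "y [^] t = y \<otimes> w" using centre_comm[OF w, of y] by (simp add: q wy)
  have x_S: "x [^] (k::nat) \<otimes> h \<in> S" if "h \<in> S" for h k
  proof -
    obtain i j :: nat where "h = x [^] i \<otimes> y [^] j" using \<open>h \<in> S\<close> by (auto simp: S_def)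
    then have "x [^] k \<otimes> h = x [^] (k + i) \<otimes> y [^] j" by (simp add: m_assoc flip: nat_pow_mult)
    then show ?thesis unfolding S_def by blast
  qed
  \<comment> \<open>Passing \<open>y\<close> over one \<open>x\<close> leaves a single
    \<open>y\<close> and the central element \<open>w = y^(2 q)\<close>, which joins the trailing
    power of \<open>y\<close>; hence \<open>j\<close> stays arbitrary in the induction.\<close>
  have y_S: "y \<otimes> (x [^] i \<otimes> y [^] j) \<in> S" for i j :: nat
  proof (induction i arbitrary: j)
    case 0
    have "y \<otimes> (x [^] (0::nat) \<otimes> y [^] j) = x [^] (0::nat) \<otimes> y [^] Suc j"
      by (simp only: nat_pow_Suc2[OF y]) simp
    then show ?case unfolding S_def by blast
  next
    case (Suc i)
    have "y \<otimes> (x [^] Suc i \<otimes> y [^] j) = y \<otimes> x \<otimes> (x [^] i \<otimes> y [^] j)"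
      unfolding nat_pow_Suc2[OF x] by (simp add: m_assoc)
    also have "\<dots> = x [^] s \<otimes> (y \<otimes> (w \<otimes> x [^] i) \<otimes> y [^] j)"
      by (simp add: rel yt m_assoc)
    also have "w \<otimes> x [^] i = x [^] i \<otimes> w" by (rule centre_comm[OF w]) simp
    also have "y \<otimes> (x [^] i \<otimes> w) \<otimes> y [^] j = y \<otimes> (x [^] i \<otimes> y [^] (2 * q + j))"
      unfolding nat_pow_mult[OF y, symmetric] wy by (simp add: m_assoc)
    finally show ?case using x_S Suc.IH by simp
  qed
  have y_S': "y [^] (k::nat) \<otimes> h \<in> S" if h: "h \<in> S" for h k
  proof (induction k)
    case 0
    have "h \<in> carrier G" using h by (auto simp: S_def)
    then show ?case using h by simp
  next
    case (Suc k)
    have [simp]: "h \<in> carrier G" using h by (auto simp: S_def)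
    have "y [^] Suc k \<otimes> h = y \<otimes> (y [^] k \<otimes> h)" unfolding nat_pow_Suc2[OF y] by (simp add: m_assoc)
    then show ?case using Suc y_S by (auto simp: S_def)
  qed
  have mult: "g \<otimes> h \<in> S" if gh: "g \<in> S" "h \<in> S" for g h
  proof -
    have [simp]: "h \<in> carrier G" using gh(2) by (auto simp: S_def)
    obtain i j :: nat where "g = x [^] i \<otimes> y [^] j" using gh(1) by (auto simp: S_def)
    then have "g \<otimes> h = x [^] i \<otimes> (y [^] j \<otimes> h)" by (simp add: m_assoc)
    then show ?thesis using x_S[OF y_S'[OF gh(2)]] by simp
  qed
  have one: "\<one> \<in> S" unfolding S_def by (rule CollectI, rule exI[of _ 0], rule exI[of _ 0]) simp
  have pow: "x [^] (k::nat) \<in> S" "y [^] (k::nat) \<in> S" for k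
    using x_S[OF one, of k] y_S'[OF one, of k] by simp_all
  have inv_pow: "inv h = h [^] (order G - 1)" if "h \<in> carrier G" for h
  proof -
    have "order G > 0" using fin that by (auto simp: order_def card_gt_0_iff)
    then have "h [^] (order G - 1) \<otimes> h = \<one>"
      using pow_order_eq_1[OF that] by (metis Suc_diff_1 nat_pow_Suc)
    then show ?thesis using that by (simp add: inv_equality)
  qed
  have "h \<in> S" if "h \<in> generate G {x, y}" for h
    using that
  proof (induction rule: generate.induct)
    case one
    then show ?case using \<open>\<one> \<in> S\<close> .
  next
    case (incl h)
    then show ?case using pow[of 1] by auto
  next
    case (inv h)
    then show ?case using pow inv_pow by auto
  next
    case (eng h1 h2)
    then show ?case using mult by blast
  qed
  then show ?thesis using g gen by (auto simp: S_def)
qed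

text \<open>The relations reduce every element to one of the \<open>M * L\<close> words
  \<open>x^a y^b\<close> with \<open>a < M\<close> and \<open>b < L\<close>. As this is the order of
  the group, no two of these words coincide; the order thus replaces a concrete model of the
  presented group.\<close>

lemma normal_form_eq_one_iff:
  assumes x [simp]: "x \<in> carrier G" and y [simp]: "y \<in> carrier G"
    and normal_form: "\<And>g. g \<in> carrier G \<Longrightarrow> \<exists>(i::nat) (j::nat). g = x [^] i \<otimes> y [^] j"
    and xM: "x [^] (M::nat) = \<one>" and yL: "y [^] (L::nat) = x [^] (k::nat)"
    and order: "order G = M * L" and pos: "M > 0" "L > 0" and j: "j < L"
  shows "x [^] (i::nat) \<otimes> y [^] (j::nat) = \<one> \<longleftrightarrow> M dvd i \<and> j = 0"
proof -
  have x_mod: "x [^] (a mod M) = x [^] a" for a :: nat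
  proof -
    have "x [^] a = x [^] (M * (a div M)) \<otimes> x [^] (a mod M)" by (simp add: nat_pow_mult)
    also have "x [^] (M * (a div M)) = \<one>"
      using nat_pow_pow[OF x, of M "a div M"] by (simp add: xM)
    finally show ?thesis by simp
  qed
  let ?f = "\<lambda>(a, b). x [^] (a::nat) \<otimes> y [^] (b::nat)"
  let ?D = "{..<M} \<times> {..<L}"
  have "?f ` ?D = carrier G"
  proof
    show "carrier G \<subseteq> ?f ` ?D"
    proof
      fix g assume "g \<in> carrier G"
      then obtain a b :: nat where g: "g = x [^] a \<otimes> y [^] b" using normal_form by blast
      define q where "q = b div L"
      have b: "b = L * q + b mod L" by (simp add: q_def)
      have "y [^] b = y [^] (L * q) \<otimes> y [^] (b mod L)" by (subst b) (simp add: nat_pow_mult)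
      also have "y [^] (L * q) = x [^] (k * q)"
        using nat_pow_pow[OF y, of L q] by (simp add: yL nat_pow_pow)
      finally have "g = x [^] (a + k * q) \<otimes> y [^] (b mod L)"
        by (simp add: g m_assoc flip: nat_pow_mult)
      then have "g = ?f ((a + k * q) mod M, b mod L)" by (simp add: x_mod)
      then show "g \<in> ?f ` ?D"
        by (rule image_eqI[where x = "((a + k * q) mod M, b mod L)"]) (use pos in simp)
    qed
  qed auto
  then have "inj_on ?f ?D"
    using order by (intro eq_card_imp_inj_on) (auto simp: order_def card_cartesian_product)
  moreover have "?f (i mod M, j) = x [^] i \<otimes> y [^] j" "?f (0, 0) = \<one>" by (simp_all add: x_mod)
  moreover have "(i mod M, j) \<in> ?D" "(0, 0) \<in> ?D" using pos j by auto
  ultimately have "x [^] i \<otimes> y [^] j = \<one> \<longleftrightarrow> (i mod M, j) = (0, 0)"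
    by (metis inj_on_eq_iff)
  then show ?thesis by auto
qed

text \<open>The common case of D, T and U, with \<open>c = 1\<close>: here \<open>u = x^(-2)\<close>
  has order \<open>M / 2\<close>, so \<open>ord u = 2\<close> reads \<open>M = 4\<close>. The pair
  \<open>L\<close>, \<open>k\<close> accommodates the different relations for a power of
  \<open>y\<close>.\<close>

lemma nccc_Q_integral_iff_inverting:
  assumes x [simp]: "x \<in> carrier G" and y [simp]: "y \<in> carrier G"
    and gen: "generate G {x, y} = carrier G"
    and xM: "x [^] (M::nat) = \<one>" and yL: "y [^] (L::nat) = x [^] (k::nat)"
    and order: "order G = M * L" and pos: "M > 0" "L > 0"
    and inverts: "y \<otimes> x = inv x \<otimes> y" and M: "even M" "even (M div 2)"
  shows "nccc_Q_integral G \<longleftrightarrow> M = 4"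
proof -
  have fin: "finite (carrier G)"
    using order pos by (metis card_gt_0_iff mult_pos_pos order_def)
  have y_inv_x: "y \<otimes> inv x = x \<otimes> y"
  proof -
    have "y \<otimes> inv x = x \<otimes> (inv x \<otimes> y) \<otimes> inv x" by (simp add: inv_cancel_left)
    also have "\<dots> = x \<otimes> (y \<otimes> x) \<otimes> inv x" by (simp add: inverts)
    finally show ?thesis by (simp add: m_assoc)
  qed
  have yy: "y \<otimes> y \<in> centre G"
  proof (rule centreI_generate[OF gen])
    have "y \<otimes> y \<otimes> x = y \<otimes> inv x \<otimes> y" by (simp add: m_assoc inverts)
    then show "y \<otimes> y \<otimes> x = x \<otimes> (y \<otimes> y)" by (simp add: y_inv_x m_assoc)
  qed (simp_all add: m_assoc)
  have "x [^] (M - 1) \<otimes> x = \<one>" using xM pos by (metis Suc_diff_1 nat_pow_Suc)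
  then have "inv x = x [^] (M - 1)" by (simp add: inv_equality)
  then have rel: "y \<otimes> x = x [^] (M - 1) \<otimes> y [^] (1::nat)" by (simp add: inverts)
  have nf: "\<exists>(i::nat) (j::nat). g = x [^] i \<otimes> y [^] j" if "g \<in> carrier G" for g
    by (rule generate_normal_form[OF fin gen x y yy rel _ that]) simp
  interpret dihedral_mod_centre G x y \<one>
    by standard (use fin nf yy in \<open>simp_all add: inverts subgroup.one_closed[OF subgroup_centre]\<close>)
  have ordu: "ord u = M div 2"
    unfolding ord_unique[OF u_carrier]
  proof
    fix n :: nat
    have "u = inv (x \<otimes> x)" by (simp add: u_def inv_mult_group)
    then have "u [^] n = inv ((x \<otimes> x) [^] n)" by (simp add: nat_pow_inv)
    also have "(x \<otimes> x) [^] n = x [^] (2 * n)"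
      using nat_pow_pow[OF x, of 2 n] by (simp add: numeral_2_eq_2)
    finally have "u [^] n = \<one> \<longleftrightarrow> x [^] (2 * n) \<otimes> y [^] (0::nat) = \<one>" by simp
    also have "\<dots> \<longleftrightarrow> M dvd 2 * n"
      using normal_form_eq_one_iff[OF x y nf xM yL order pos, of 0 "2 * n"] pos by simp
    also have "\<dots> \<longleftrightarrow> M div 2 dvd n" using M by (auto elim!: evenE)
    finally show "u [^] n = \<one> \<longleftrightarrow> M div 2 dvd n" .
  qed
  interpret even_dihedral_mod_centre G x y \<one>
    by standard (simp add: ordu M)
  show ?thesis using nccc_Q_integral_iff M by (auto simp: ordu)
qed

section \<open>The groups D, T and U, where one generator inverts the other\<close>

lemma nccc_Q_integral_D_iff:
  assumes "is_D G m" and m: "m > 0" "even m" "even (m div 2)"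
  shows "nccc_Q_integral G \<longleftrightarrow> m = 4"
proof -
  obtain x y where [simp]: "x \<in> carrier G" "y \<in> carrier G" and gen: "generate G {x, y} = carrier G"
    and order: "order G = 2 * m" and xm: "x [^] m = \<one>" and y2: "y [^] (2::nat) = \<one>"
    and rel: "y \<otimes> x \<otimes> inv y = inv x"
    using assms(1) unfolding is_D_def by blast
  have "y \<otimes> x \<otimes> inv y \<otimes> y = inv x \<otimes> y" by (simp add: rel)
  then have "y \<otimes> x = inv x \<otimes> y" by (simp add: m_assoc)
  then show ?thesis
    using nccc_Q_integral_iff_inverting[of x y m 2 0] gen order xm y2 m by (simp add: mult.commute)
qed

text \<open>Inversion is an involution, so conjugation by \<open>inv y\<close> inverts
  \<open>x\<close> as soon as conjugation by \<open>y\<close> does, and conversely. This adapts the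
  relations of T and U to the shape required above.\<close>

lemma inverts_if_inv_conj:
  assumes [simp]: "x \<in> carrier G" "y \<in> carrier G" and rel: "inv y \<otimes> x \<otimes> y = inv x"
  shows "y \<otimes> x = inv x \<otimes> y"
proof -
  have "y \<otimes> inv x = x \<otimes> y" unfolding rel[symmetric] by (simp add: m_assoc inv_cancel_left)
  then have "inv x \<otimes> (y \<otimes> inv x) \<otimes> x = inv x \<otimes> (x \<otimes> y) \<otimes> x" by simp
  then show ?thesis by (simp add: m_assoc inv_cancel_left)
qed

lemma nccc_Q_integral_T_iff:
  assumes "is_T G m" and m: "m > 0" "even m"
  shows "nccc_Q_integral G \<longleftrightarrow> m = 2"
proof -
  obtain x y where [simp]: "x \<in> carrier G" "y \<in> carrier G" and gen: "generate G {x, y} = carrier G"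
    and order: "order G = 4 * m" and xm: "x [^] (2 * m) = \<one>" and y2: "x [^] m = y [^] (2::nat)"
    and rel: "inv y \<otimes> x \<otimes> y = inv x"
    using assms(1) unfolding is_T_def by blast
  have "y \<otimes> x = inv x \<otimes> y" using rel by (intro inverts_if_inv_conj) simp_all
  then show ?thesis
    using nccc_Q_integral_iff_inverting[of x y "2 * m" 2 m] gen order xm y2 m by simp
qed

lemma nccc_Q_integral_U_iff:
  assumes "is_U G n m" and m: "m > 0" "even m" "even (m div 2)" and n: "n > 0"
  shows "nccc_Q_integral G \<longleftrightarrow> m = 4"
proof -
  obtain x y where [simp]: "x \<in> carrier G" "y \<in> carrier G" and gen: "generate G {x, y} = carrier G"
    and order: "order G = 2 * n * m" and xn: "x [^] (2 * n) = \<one>" and ym: "y [^] m = \<one>"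
    and rel: "inv x \<otimes> y \<otimes> x = inv y"
    using assms(1) unfolding is_U_def by blast
  \<comment> \<open>The generators exchange roles: \<open>y\<close> is the rotation and
    \<open>x\<close> the reflection.\<close>
  have "x \<otimes> y = inv y \<otimes> x" using rel by (intro inverts_if_inv_conj) simp_all
  then show ?thesis
    using nccc_Q_integral_iff_inverting[of y x m "2 * n" 0] gen order xn ym m n
    by (simp add: mult.commute insert_commute)
qed

text \<open>Here \<open>c = y^2\<close> is central with square 1, and \<open>u = x^(-2) y^2\<close>.
  So \<open>u^n = 1\<close> requires \<open>n\<close> to be even and a multiple of \<open>m\<close>,
  and the order \<open>lcm m 2\<close> is 2 only for \<open>m = 2\<close>.\<close>

lemma nccc_Q_integral_V_iff:
  assumes "is_V G m" and m: "m \<ge> 2"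
  shows "nccc_Q_integral G \<longleftrightarrow> m = 2"
proof -
  obtain x y where x [simp]: "x \<in> carrier G" and y [simp]: "y \<in> carrier G"
    and gen: "generate G {x, y} = carrier G"
    and order: "order G = 8 * m" and xm: "x [^] (2 * m) = \<one>" and y4: "y [^] (4::nat) = \<one>"
    and rel1: "y \<otimes> x = inv x \<otimes> inv y" and rel2: "inv y \<otimes> x = inv x \<otimes> y"
    using assms(1) unfolding is_V_def by blast
  have fin: "finite (carrier G)"
    using order m by (intro card_ge_0_finite) (simp add: order_def)
  define z where "z = y \<otimes> y"
  have [simp]: "z \<in> carrier G" by (simp add: z_def)
  have zz: "z \<otimes> z = \<one>"
    using y4 by (simp add: z_def numeral_eq_Suc m_assoc)
  have inv_z: "inv z = z" using zz by (simp add: inv_equality)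
  have inv_y: "inv y = z \<otimes> y"
    using zz by (intro inv_equality) (simp_all add: z_def m_assoc)
  have y_inv_x: "y \<otimes> inv x = x \<otimes> inv y"
  proof -
    have "y \<otimes> inv x = y \<otimes> (inv x \<otimes> y) \<otimes> inv y" by (simp add: m_assoc)
    also have "\<dots> = y \<otimes> (inv y \<otimes> x) \<otimes> inv y" by (simp add: rel2)
    finally show ?thesis by (simp add: inv_cancel_left)
  qed
  have "z \<otimes> x = y \<otimes> inv x \<otimes> inv y" by (simp add: z_def m_assoc rel1)
  also have "\<dots> = x \<otimes> inv z" by (simp add: y_inv_x m_assoc z_def inv_mult_group)
  finally have zx: "z \<otimes> x = x \<otimes> z" by (simp add: inv_z)
  have z: "z \<in> centre G"
    by (rule centreI_generate[OF gen _ _ zx]) (simp_all add: z_def m_assoc)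
  have "x [^] (2 * m - 1) \<otimes> x = \<one>" using xm m by (metis Suc_diff_1 mult_2 add_pos_pos nat_pow_Suc pos2 order.strict_trans2)
  then have inv_x: "inv x = x [^] (2 * m - 1)" by (simp add: inv_equality)
  have rel: "y \<otimes> x = x [^] (2 * m - 1) \<otimes> y [^] (3::nat)"
    unfolding inv_x[symmetric] rel1 inv_y by (simp add: z_def numeral_eq_Suc)
  have nf: "\<exists>(i::nat) (j::nat). g = x [^] i \<otimes> y [^] j" if "g \<in> carrier G" for g
    by (rule generate_normal_form[OF fin gen x y z[unfolded z_def] rel _ that]) simp
  interpret dihedral_mod_centre G x y z
  proof
    show "y \<otimes> x = inv x \<otimes> z \<otimes> y" by (simp add: rel1 inv_y m_assoc)
  qed (use fin nf z z_def in auto)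
  have ordu: "ord u = lcm m 2"
    unfolding ord_unique[OF u_carrier]
  proof
    fix n :: nat
    \<comment> \<open>Since \<open>z^2 = 1\<close>, only the parity of \<open>n\<close> matters:
      \<open>z^n = y^j\<close> with \<open>j\<close> equal to 0 or 2, below the bound 4 demanded by
      the normal form criterion.\<close>
    define j where "j = 2 * (n mod 2)"
    have z2: "z [^] (2 * k) = \<one>" for k :: nat
      using nat_pow_pow[of z 2 k] zz by (simp add: numeral_2_eq_2)
    have zy: "z [^] k = y [^] (2 * k)" for k :: nat
      using nat_pow_pow[OF y, of 2 k] by (simp add: z_def numeral_2_eq_2)
    have "z [^] n = z [^] (2 * (n div 2)) \<otimes> z [^] (n mod 2)" by (simp add: nat_pow_mult)
    also have "\<dots> = z [^] (n mod 2)" by (simp only: z2) simp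
    finally have zn: "z [^] n = y [^] j" by (simp add: zy j_def)
    have znzn: "z [^] n \<otimes> z [^] n = \<one>" using z2[of n] by (simp add: nat_pow_mult mult_2)
    have "u [^] int n = x [^] (- int (2 * n)) \<otimes> z [^] int n" by (simp add: u_pow)
    then have u: "x [^] (2 * n) \<otimes> u [^] n = z [^] n"
      by (simp only: int_pow_neg int_pow_int x inv_cancel_left nat_pow_closed c_carrier)
    have "u [^] n = \<one> \<longleftrightarrow> x [^] (2 * n) = z [^] n"
      using l_cancel_one[of "x [^] (2 * n)" "u [^] n"] u by auto
    \<comment> \<open>\<open>z^n\<close> is its own inverse, so it can be moved to the other
      side.\<close>
    also have "\<dots> \<longleftrightarrow> x [^] (2 * n) \<otimes> y [^] j = \<one>"
      unfolding zn[symmetric] znzn[symmetric] by (subst r_cancel) auto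
    also have "\<dots> \<longleftrightarrow> 2 * m dvd 2 * n \<and> j = 0"
      by (rule normal_form_eq_one_iff[OF x y nf xm, of 4 0]) (use order y4 m in \<open>simp_all add: j_def\<close>)
    also have "\<dots> \<longleftrightarrow> lcm m 2 dvd n" by (auto simp: j_def)
    finally show "u [^] n = \<one> \<longleftrightarrow> lcm m 2 dvd n" .
  qed
  interpret even_dihedral_mod_centre G x y z
    by standard (simp add: ordu)
  have "lcm m 2 = 2 \<longleftrightarrow> m = 2"
  proof
    assume "lcm m 2 = 2"
    then have "m dvd 2" by (metis dvd_lcm1)
    then show "m = 2" using m by (auto dest: dvd_imp_le)
  qed simp
  then show ?thesis using nccc_Q_integral_iff by (simp add: ordu)
qed

text \<open>Here \<open>c = x^(2 m)\<close>, so \<open>u = x^(2 m - 2)\<close>. For even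
  \<open>m\<close> the number \<open>m - 1\<close> is coprime to \<open>2 m\<close>, hence
  \<open>u\<close> has order \<open>2 m\<close>, which is at least 4.\<close>

lemma not_nccc_Q_integral_SD:
  assumes "is_SD G m" and m: "m \<ge> 2" "even m"
  shows "\<not> nccc_Q_integral G"
proof -
  obtain x y where x [simp]: "x \<in> carrier G" and y [simp]: "y \<in> carrier G"
    and gen: "generate G {x, y} = carrier G"
    and order: "order G = 8 * m" and xm: "x [^] (4 * m) = \<one>" and y2: "y [^] (2::nat) = \<one>"
    and rel0: "y \<otimes> x \<otimes> y = x [^] (2 * m - 1)"
    using assms(1) unfolding is_SD_def by blast
  have fin: "finite (carrier G)"
    using order m by (intro card_ge_0_finite) (simp add: order_def)
  have yy: "y \<otimes> y = \<one>" using y2 by (simp add: numeral_2_eq_2)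
  define c where "c = x [^] (2 * m)"
  have [simp]: "c \<in> carrier G" by (simp add: c_def)
  have "y \<otimes> x = y \<otimes> x \<otimes> (y \<otimes> y)" by (simp add: yy)
  also have "\<dots> = y \<otimes> x \<otimes> y \<otimes> y" by (simp add: m_assoc)
  finally have rel1: "y \<otimes> x = x [^] (2 * m - 1) \<otimes> y" by (simp add: rel0)
  then have rel: "y \<otimes> x = x [^] (2 * m - 1) \<otimes> y [^] (1::nat)" by simp
  have y_pow: "y \<otimes> x [^] n = x [^] ((2 * m - 1) * n) \<otimes> y" for n :: nat
  proof (induction n)
    case (Suc n)
    have "y \<otimes> x [^] Suc n = x [^] ((2 * m - 1) * n) \<otimes> (y \<otimes> x)"
      using Suc by (simp flip: m_assoc)
    also have "\<dots> = x [^] ((2 * m - 1) * Suc n) \<otimes> y"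
      by (simp add: rel1 nat_pow_mult add.commute flip: m_assoc)
    finally show ?case .
  qed simp
  have c: "c \<in> centre G"
  proof (rule centreI_generate[OF gen])
    \<comment> \<open>Conjugation by \<open>y\<close> multiplies exponents of \<open>x\<close> by
      \<open>2 m - 1\<close>. Modulo \<open>4 m\<close> this fixes the exponent \<open>2 m\<close>,
      so \<open>y\<close> commutes with \<open>c\<close>.\<close>
    have "(2 * m - 1) * (2 * m) = 2 * m + 4 * m * (m - 1)"
      using m by (cases m) (simp_all add: algebra_simps)
    then have "x [^] ((2 * m - 1) * (2 * m)) = c"
      using nat_pow_pow[OF x, of "4 * m" "m - 1"] by (simp add: c_def xm flip: nat_pow_mult)
    then show "c \<otimes> y = y \<otimes> c" by (simp add: c_def y_pow)
    show "c \<otimes> x = x \<otimes> c" unfolding c_def by (rule group_commutes_pow) simp_all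
  qed simp_all
  have nf: "\<exists>(i::nat) (j::nat). g = x [^] i \<otimes> y [^] j" if "g \<in> carrier G" for g
    by (rule generate_normal_form[OF fin gen x y _ rel _ that])
      (simp_all add: yy subgroup.one_closed[OF subgroup_centre])
  have inv_x_c: "inv x \<otimes> c = x [^] (2 * m - 1)"
  proof -
    have "c = x \<otimes> x [^] (2 * m - 1)"
      using nat_pow_Suc2[OF x, of "2 * m - 1"] m by (simp add: c_def)
    then show ?thesis by (simp add: inv_cancel_left)
  qed
  interpret dihedral_mod_centre G x y c
    by standard
      (use fin nf c in \<open>simp_all add: yy rel1 inv_x_c subgroup.one_closed[OF subgroup_centre]\<close>)
  have "u = x [^] (2 * m - 2)"
  proof -
    have "x [^] (2 * m - 1) = x \<otimes> x [^] (2 * m - 2)"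
      using nat_pow_Suc2[OF x, of "2 * m - 2"] m
      by (metis Suc_diff_Suc Suc_1 less_le_trans lessI mult_2 trans_less_add1)
    then show ?thesis by (simp add: u_def m_assoc inv_x_c inv_cancel_left)
  qed
  then have u_nat_pow: "u [^] n = x [^] ((2 * m - 2) * n) \<otimes> y [^] (0::nat)" for n :: nat
    by (simp add: nat_pow_pow)
  have ordu: "ord u = 2 * m"
    unfolding ord_unique[OF u_carrier]
  proof
    fix n :: nat
    have "u [^] n = \<one> \<longleftrightarrow> 4 * m dvd (2 * m - 2) * n"
      unfolding u_nat_pow
      using normal_form_eq_one_iff[OF x y nf xm, of 2 0 0 "(2 * m - 2) * n"] order y2 m by simp
    also have "\<dots> \<longleftrightarrow> 2 * (2 * m) dvd 2 * ((m - 1) * n)" by (simp add: algebra_simps)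
    also have "\<dots> \<longleftrightarrow> 2 * m dvd (m - 1) * n" by (simp only: nat_mult_dvd_cancel_disj) simp
    also have "\<dots> \<longleftrightarrow> 2 * m dvd n"
    proof -
      have "coprime (2 * m) (m - 1)"
        using m coprime_diff_one_right_nat[of m] by simp
      then show ?thesis by (simp add: coprime_dvd_mult_right_iff)
    qed
    finally show "u [^] n = \<one> \<longleftrightarrow> 2 * m dvd n" .
  qed
  interpret even_dihedral_mod_centre G x y c
    by standard (simp add: ordu)
  show ?thesis using nccc_Q_integral_iff m by (simp add: ordu)
qed

end

theorem theorem3p4:
  fixes G :: "('a, 'b) monoid_scheme"
  assumes "group G"
  shows
    "(\<forall>m::nat. m \<ge> 4 \<and> even m \<and> even (m div 2) \<and>
        (is_D G m \<or> (\<exists>n::nat. n \<ge> 2 \<and> is_U G n m)) \<longrightarrow>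
        (nccc_Q_integral G \<longleftrightarrow> m = 4))
   \<and> (\<forall>m::nat. m \<ge> 2 \<and> even m \<and> is_T G m \<longrightarrow> (nccc_Q_integral G \<longleftrightarrow> m = 2))
   \<and> (\<forall>m::nat. m \<ge> 2 \<and> is_V G m \<longrightarrow> (nccc_Q_integral G \<longleftrightarrow> m = 2))
   \<and> (\<forall>m::nat. m \<ge> 2 \<and> even m \<and> is_SD G m \<longrightarrow> \<not> nccc_Q_integral G)"
proof -
  interpret group G by (rule assms)
  have "nccc_Q_integral G \<longleftrightarrow> m = 4"
    if "m \<ge> 4" "even m" "even (m div 2)" "is_D G m \<or> (\<exists>n\<ge>2. is_U G n m)" for m :: nat
    using that nccc_Q_integral_D_iff[of m] nccc_Q_integral_U_iff[of _ m] by fastforce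
  moreover have "nccc_Q_integral G \<longleftrightarrow> m = 2" if "m \<ge> 2" "even m" "is_T G m" for m
    using that nccc_Q_integral_T_iff[of m] by simp
  ultimately show ?thesis
    using nccc_Q_integral_V_iff not_nccc_Q_integral_SD by blast
qed

end
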